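(* Let $\Omega\subseteq\mathbb{H}$ be a symmetric slice domain and let $\mathcal{H}$ be a reproducing kernel Hilbert space of (slice) regular functions on $\Omega$, with reproducing kernel $k(w,q)=k_w(q)$. Suppose that $k$ is slice preserving: for any $w\in\Omega$ the kernel function $k_w$ preserves the slice $L_{I_w}$ identified by $w$, i.e. $k_w(\Omega\cap L_{I_w})\subseteq L_{I_w}$. Then the length of a tangent vector $d=d_1+d_2\in L_{I_w}+L_{I_w}^\perp\cong T_w\Omega$ (with $d_1\in L_{I_w}$, $d_2\in L_{I_w}^\perp$) with respect to the Riemannian metric $g_{\mathcal{H}}$ associated with $\mathcal{H}$ is given by $$|d|^2_{g_{\mathcal{H}}(w)}=\frac{\|k_w\|_{\mathcal{H}}^2\left\|\overline{\partial_ck_q(w)}\right\|_{\mathcal{H}}^2-\left|\overline{\partial_ck_w(w)}\right|^2}{\|k_w\|_{\mathcal{H}}^4}|d_1|^2+\frac{\|k_w\|_{\mathcal{H}}^2\left\|\overline{\partial_sk_q(w)}\right\|_{\mathcal{H}}^2-\left|\overline{\partial_sk_w(w)}\right|^2}{\|k_w\|_{\mathcal{H}}^4}|d_2|^2.$$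
   Context: $\mathbb{H}$ is the skew-field of quaternions; $\mathbb{S}=\{q\in\mathbb{H}:q^2=-1\}$; for $I\in\mathbb{S}$, $L_I=\mathbb{R}+\mathbb{R}I$ and $\Omega_I=\Omega\cap L_I$. Each $w\in\mathbb{H}$ is $w=x+yI_w$ with $x,y\in\mathbb{R}$, $I_w\in\mathbb{S}$ (if $w$ is real, $I_w$ may be any element of $\mathbb{S}$); $L_{I_w}^\perp$ is the Euclidean orthogonal complement of $L_{I_w}$ in $\mathbb{H}$. A domain $\Omega\subseteq\mathbb{H}$ is a slice domain if it meets $\mathbb{R}$ and each $\Omega_I$ is a domain in $L_I$; it is symmetric if $x+yI\in\Omega$ implies $x+y\mathbb{S}\subseteq\Omega$. A function $f:\Omega\to\mathbb{H}$ is (slice) regular if for each $I\in\mathbb{S}$ the restriction $f_I=f|_{\Omega_I}$ has continuous partial derivatives and $\frac12(\partial_x+I\partial_y)f_I(x+yI)=0$ on $\Omega_I$. Its slice derivative is $\partial_cf(x+yI)=\frac12(\partial_x-I\partial_y)f_I(x+yI)$, and its spherical derivative is $\partial_sf(q)=(q-\overline q)^{-1}(f(q)-f(\overline q))$ for $q\notin\mathbb{R}$, extended by continuity at real points (where it equals $\partial_cf$). A reproducing kernel Hilbert space $\mathcal{H}$ here is a right quaternionic Hilbert space of functions with $\mathbb{H}$-valued inner product satisfying $\langle fa,gb\rangle_{\mathcal{H}}=\overline b\langle f,g\rangle_{\mathcal{H}}a$ for $a,b\in\mathbb{H}$, with $k_w\in\mathcal{H}$, $k_w\ne0$, and $f(w)=\langle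 f,k_w\rangle_{\mathcal{H}}$ for all $f\in\mathcal{H}$, $w\in\Omega$. The expressions $\overline{\partial_ck_q(w)}$ and $\overline{\partial_sk_q(w)}$ denote the functions of $q\in\Omega$ obtained by taking the slice (resp. spherical) derivative of the regular function $k_q$, evaluating it at the point $w$, and conjugating; they belong to $\mathcal{H}$. $\partial_ck_w(w)$, $\partial_sk_w(w)$ are the derivatives of $k_w$ evaluated at $w$. The Riemannian metric $g_{\mathcal{H}}$ associated with $\mathcal{H}$ is defined, for $w\in\Omega$ and $d=d_1+d_2\in L_{I_w}+L_{I_w}^\perp\cong T_w\Omega$, by $$|d|^2_{g_{\mathcal{H}}(w)}=\frac{\|k_w\|_{\mathcal{H}}^2\left\|\overline{d_1\partial_ck_q(w)+d_2\partial_sk_q(w)}\right\|_{\mathcal{H}}^2-\left|\left\langle k_w,\overline{d_1\partial_ck_q(w)+d_2\partial_sk_q(w)}\right\rangle_{\mathcal{H}}\right|^2}{\|k_w\|_{\mathcal{H}}^4}.$$ *)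

theory Defs
  imports "HOL-Analysis.Analysis"
begin

section \<open>The skew-field of quaternions\<close>

datatype quat = Quat (qre: real) (qim1: real) (qim2: real) (qim3: real)

lemma quat_eq_iff:
  "p = q \<longleftrightarrow> qre p = qre q \<and> qim1 p = qim1 q \<and> qim2 p = qim2 q \<and> qim3 p = qim3 q"
  by (cases p; cases q) simp

instantiation quat :: real_vector
begin

definition zero_quat :: quat where "0 = Quat 0 0 0 0"

definition plus_quat :: "quat \<Rightarrow> quat \<Rightarrow> quat" where
  "p + q = Quat (qre p + qre q) (qim1 p + qim1 q) (qim2 p + qim2 q) (qim3 p + qim3 q)"

definition uminus_quat :: "quat \<Rightarrow> quat" where
  "- q = Quat (- qre q) (- qim1 q) (- qim2 q) (- qim3 q)"

definition minus_quat :: "quat \<Rightarrow> quat \<Rightarrow> quat" where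
  "p - q = Quat (qre p - qre q) (qim1 p - qim1 q) (qim2 p - qim2 q) (qim3 p - qim3 q)"

definition scaleR_quat :: "real \<Rightarrow> quat \<Rightarrow> quat" where
  "c *\<^sub>R q = Quat (c * qre q) (c * qim1 q) (c * qim2 q) (c * qim3 q)"

instance
  by standard
    (simp_all add: quat_eq_iff zero_quat_def plus_quat_def uminus_quat_def minus_quat_def
      scaleR_quat_def algebra_simps)

end

instantiation quat :: real_algebra_1
begin

definition one_quat :: quat where "1 = Quat 1 0 0 0"

definition times_quat :: "quat \<Rightarrow> quat \<Rightarrow> quat" where
  "p * q = Quat
    (qre p * qre q - qim1 p * qim1 q - qim2 p * qim2 q - qim3 p * qim3 q)
    (qre p * qim1 q + qim1 p * qre q + qim2 p * qim3 q - qim3 p * qim2 q)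
    (qre p * qim2 q - qim1 p * qim3 q + qim2 p * qre q + qim3 p * qim1 q)
    (qre p * qim3 q + qim1 p * qim2 q - qim2 p * qim1 q + qim3 p * qre q)"

instance
  by standard
    (simp_all add: quat_eq_iff zero_quat_def plus_quat_def scaleR_quat_def one_quat_def
      times_quat_def algebra_simps)

end

lemma quat_sel_simps [simp]:
  "qre 0 = 0" "qim1 0 = 0" "qim2 0 = 0" "qim3 0 = 0"
  "qre 1 = 1" "qim1 1 = 0" "qim2 1 = 0" "qim3 1 = 0"
  "qre (p + q) = qre p + qre q" "qim1 (p + q) = qim1 p + qim1 q"
  "qim2 (p + q) = qim2 p + qim2 q" "qim3 (p + q) = qim3 p + qim3 q"
  "qre (p - q) = qre p - qre q" "qim1 (p - q) = qim1 p - qim1 q"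
  "qim2 (p - q) = qim2 p - qim2 q" "qim3 (p - q) = qim3 p - qim3 q"
  "qre (- q) = - qre q" "qim1 (- q) = - qim1 q"
  "qim2 (- q) = - qim2 q" "qim3 (- q) = - qim3 q"
  "qre (c *\<^sub>R q) = c * qre q" "qim1 (c *\<^sub>R q) = c * qim1 q"
  "qim2 (c *\<^sub>R q) = c * qim2 q" "qim3 (c *\<^sub>R q) = c * qim3 q"
  by (simp_all add: zero_quat_def one_quat_def plus_quat_def minus_quat_def uminus_quat_def
      scaleR_quat_def)

lemma quat_sel_mult:
  "qre (p * q) = qre p * qre q - qim1 p * qim1 q - qim2 p * qim2 q - qim3 p * qim3 q"
  "qim1 (p * q) = qre p * qim1 q + qim1 p * qre q + qim2 p * qim3 q - qim3 p * qim2 q"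
  "qim2 (p * q) = qre p * qim2 q - qim1 p * qim3 q + qim2 p * qre q + qim3 p * qim1 q"
  "qim3 (p * q) = qre p * qim3 q + qim1 p * qim2 q - qim2 p * qim1 q + qim3 p * qre q"
  by (simp_all add: times_quat_def)

lemma quat_sel_of_real [simp]:
  "qre (of_real x) = x" "qim1 (of_real x) = 0" "qim2 (of_real x) = 0" "qim3 (of_real x) = 0"
  by (simp_all add: of_real_def)

definition qcnj :: "quat \<Rightarrow> quat" where
  "qcnj q = Quat (qre q) (- qim1 q) (- qim2 q) (- qim3 q)"

lemma qcnj_sel [simp]:
  "qre (qcnj q) = qre q" "qim1 (qcnj q) = - qim1 q"
  "qim2 (qcnj q) = - qim2 q" "qim3 (qcnj q) = - qim3 q"
  by (simp_all add: qcnj_def)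

instantiation quat :: real_normed_vector
begin

definition norm_quat :: "quat \<Rightarrow> real" where
  "norm q = sqrt ((qre q)\<^sup>2 + (qim1 q)\<^sup>2 + (qim2 q)\<^sup>2 + (qim3 q)\<^sup>2)"

definition sgn_quat :: "quat \<Rightarrow> quat" where "sgn (q :: quat) = q /\<^sub>R norm q"

definition dist_quat :: "quat \<Rightarrow> quat \<Rightarrow> real" where "dist (p :: quat) q = norm (p - q)"

definition uniformity_quat :: "(quat \<times> quat) filter" where
  "uniformity = (INF e\<in>{0 <..}. principal {(p :: quat, q). dist p q < e})"

definition open_quat :: "quat set \<Rightarrow> bool" where
  "open (U :: quat set) \<longleftrightarrow> (\<forall>p\<in>U. eventually (\<lambda>(p', q). p' = p \<longrightarrow> q \<in> U) uniformity)"

instance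
proof
  fix p q :: quat and c :: real
  have tuple: "norm r = norm ((qre r, qim1 r), (qim2 r, qim3 r))" for r :: quat
    by (simp add: norm_quat_def norm_prod_def add.assoc)
  show "norm p = 0 \<longleftrightarrow> p = 0"
    unfolding tuple by (simp add: prod_eq_iff quat_eq_iff)
  show "norm (p + q) \<le> norm p + norm q"
    unfolding tuple
    using norm_triangle_ineq[of "((qre p, qim1 p), (qim2 p, qim3 p))"
        "((qre q, qim1 q), (qim2 q, qim3 q))"]
    by simp
  show "norm (c *\<^sub>R p) = \<bar>c\<bar> * norm p"
    unfolding tuple
    using norm_scaleR[of c "((qre p, qim1 p), (qim2 p, qim3 p))"]
    by simp
qed (simp_all add: sgn_quat_def dist_quat_def uniformity_quat_def open_quat_def)

end

instantiation quat :: real_inner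
begin

definition inner_quat :: "quat \<Rightarrow> quat \<Rightarrow> real" where
  "p \<bullet> q = qre p * qre q + qim1 p * qim1 q + qim2 p * qim2 q + qim3 p * qim3 q"

instance
proof
  fix p :: quat
  show norm_inner: "norm p = sqrt (p \<bullet> p)"
    by (simp add: norm_quat_def inner_quat_def power2_eq_square)
  show nonneg: "0 \<le> p \<bullet> p"
    by (simp add: inner_quat_def)
  show "p \<bullet> p = 0 \<longleftrightarrow> p = 0"
    using norm_inner norm_eq_zero[of p] by simp
qed (simp_all add: inner_quat_def algebra_simps)

end

lemma norm_quat_square: "(norm (q :: quat))\<^sup>2 = q \<bullet> q"
  by (rule power2_norm_eq_inner)

lemma mult_qcnj: "q * qcnj q = of_real ((norm q)\<^sup>2)" "qcnj q * q = of_real ((norm q)\<^sup>2)"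
  by (simp_all add: norm_quat_square inner_quat_def quat_eq_iff quat_sel_mult algebra_simps)

instantiation quat :: real_normed_div_algebra
begin

definition inverse_quat :: "quat \<Rightarrow> quat" where
  "inverse (q :: quat) = qcnj q /\<^sub>R (norm q)\<^sup>2"

definition divide_quat :: "quat \<Rightarrow> quat \<Rightarrow> quat" where
  "(p :: quat) div q = p * inverse q"

instance
proof
  fix p q :: quat
  show "q \<noteq> 0 \<Longrightarrow> inverse q * q = 1" "q \<noteq> 0 \<Longrightarrow> q * inverse q = 1"
    unfolding inverse_quat_def mult_scaleR_left mult_scaleR_right mult_qcnj of_real_def
    by simp_all
  have "(norm (p * q))\<^sup>2 = (norm p * norm q)\<^sup>2"
    unfolding power_mult_distrib norm_quat_square inner_quat_def quat_sel_mult
    by (simp add: algebra_simps)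
  then show "norm (p * q) = norm p * norm q"
    by simp
qed (simp_all add: divide_quat_def inverse_quat_def quat_eq_iff)

end


section \<open>Slices and symmetric slice domains\<close>

definition imag_units :: "quat set" where
  "imag_units = {q. q\<^sup>2 = -1}"

definition slice :: "quat \<Rightarrow> quat set" where
  "slice I = {of_real x + of_real y * I |x y. True}"

definition slice_domain :: "quat set \<Rightarrow> bool" where
  "slice_domain \<Omega> \<longleftrightarrow> open \<Omega> \<and> connected \<Omega> \<and> \<Omega> \<inter> \<real> \<noteq> {} \<and>
    (\<forall>I\<in>imag_units. openin (top_of_set (slice I)) (\<Omega> \<inter> slice I) \<and> connected (\<Omega> \<inter> slice I))"

definition symmetric_domain :: "quat set \<Rightarrow> bool" where
  "symmetric_domain \<Omega> \<longleftrightarrow>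
    (\<forall>x y. \<forall>I\<in>imag_units. of_real x + of_real y * I \<in> \<Omega> \<longrightarrow>
      (\<forall>J\<in>imag_units. of_real x + of_real y * J \<in> \<Omega>))"

text \<open>
  A unit \<open>I\<^sub>w\<close> with \<open>w \<in> slice I\<^sub>w\<close>. For non-real \<open>w\<close> it is determined up to sign, so
  its slice is determined; for real \<open>w\<close> it is an arbitrary element of \<open>imag_units\<close>.
\<close>
definition slice_unit :: "quat \<Rightarrow> quat" where
  "slice_unit w = (SOME I. I \<in> imag_units \<and> w \<in> slice I)"

text \<open>Orthogonal projection onto \<open>slice I\<close>, for \<open>I \<in> imag_units\<close>.\<close>
definition slice_proj :: "quat \<Rightarrow> quat \<Rightarrow> quat" where
  "slice_proj I d = of_real (qre d) + of_real (d \<bullet> I) * I"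

lemma imag_units_iff: "I \<in> imag_units \<longleftrightarrow> qre I = 0 \<and> I \<bullet> I = 1"
proof
  assume "I \<in> imag_units"
  then have *: "qre (I * I) = -1" "qim1 (I * I) = 0" "qim2 (I * I) = 0" "qim3 (I * I) = 0"
    by (simp_all add: imag_units_def power2_eq_square)
  have "qre I = 0"
  proof (rule ccontr)
    assume "qre I \<noteq> 0"
    with * have "qim1 I = 0" "qim2 I = 0" "qim3 I = 0"
      by (simp_all add: quat_sel_mult)
    with *(1) have "qre I * qre I = -1" by (simp add: quat_sel_mult)
    then show False
      using zero_le_square[of "qre I"] by linarith
  qed
  with *(1) show "qre I = 0 \<and> I \<bullet> I = 1"
    by (simp add: quat_sel_mult inner_quat_def)
next
  assume "qre I = 0 \<and> I \<bullet> I = 1"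
  then show "I \<in> imag_units"
    by (auto simp add: imag_units_def power2_eq_square quat_eq_iff quat_sel_mult inner_quat_def)
qed

lemma slice_proj_decomp:
  assumes "I \<in> imag_units" "d1 \<in> slice I" "d2 \<in> orthogonal_comp (slice I)"
  shows "slice_proj I (d1 + d2) = d1"
proof -
  from assms(2) obtain x y where d1: "d1 = of_real x + of_real y * I"
    by (auto simp: slice_def)
  have perp: "d2 \<bullet> (of_real a + of_real b * I) = 0" for a b
    using assms(3) unfolding orthogonal_comp_def orthogonal_def slice_def
    by (subst inner_commute) blast
  have "qre d2 = 0" "d2 \<bullet> I = 0"
    using perp[of 1 0] perp[of 0 1] by (simp_all add: inner_quat_def)
  moreover have "of_real x \<bullet> I = 0" "qre I = 0" "I \<bullet> I = 1"
    using assms(1) by (auto simp: imag_units_iff inner_quat_def)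
  then have "qre d1 = x" "d1 \<bullet> I = y"
    by (simp_all add: d1 inner_add_left quat_sel_mult flip: scaleR_conv_of_real)
  ultimately show ?thesis
    by (simp add: slice_proj_def inner_add_left d1)
qed


section \<open>Slice regular functions\<close>

definition slice_dx :: "quat \<Rightarrow> (quat \<Rightarrow> quat) \<Rightarrow> real \<Rightarrow> real \<Rightarrow> quat" where
  "slice_dx I f x y = vector_derivative (\<lambda>t. f (of_real t + of_real y * I)) (at x)"

definition slice_dy :: "quat \<Rightarrow> (quat \<Rightarrow> quat) \<Rightarrow> real \<Rightarrow> real \<Rightarrow> quat" where
  "slice_dy I f x y = vector_derivative (\<lambda>t. f (of_real x + of_real t * I)) (at y)"

definition slice_regular :: "(quat \<Rightarrow> quat) \<Rightarrow> quat set \<Rightarrow> bool" where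
  "slice_regular f \<Omega> \<longleftrightarrow> (\<forall>I\<in>imag_units.
    (\<forall>x y. of_real x + of_real y * I \<in> \<Omega> \<longrightarrow>
      (\<lambda>t. f (of_real t + of_real y * I)) differentiable (at x) \<and>
      (\<lambda>t. f (of_real x + of_real t * I)) differentiable (at y) \<and>
      (1/2) *\<^sub>R (slice_dx I f x y + I * slice_dy I f x y) = 0) \<and>
    continuous_on {(x, y). of_real x + of_real y * I \<in> \<Omega>} (\<lambda>(x, y). slice_dx I f x y) \<and>
    continuous_on {(x, y). of_real x + of_real y * I \<in> \<Omega>} (\<lambda>(x, y). slice_dy I f x y))"

text \<open>
  If \<open>q \<in> slice I\<close> with \<open>I \<in> imag_units\<close>, then \<open>q = x + y I\<close> with \<open>x = qre q\<close> and
  \<open>y = q \<bullet> I\<close>. For regular \<open>f\<close> the value does not depend on the choice of \<open>I\<close>.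
\<close>
definition slice_deriv :: "(quat \<Rightarrow> quat) \<Rightarrow> quat \<Rightarrow> quat" where
  "slice_deriv f q = (let I = slice_unit q; x = qre q; y = q \<bullet> I in
    (1/2) *\<^sub>R (slice_dx I f x y - I * slice_dy I f x y))"

text \<open>
  At real points the difference quotient is extended by continuity; the limit is taken
  through non-real points, the only ones where the quotient is defined.
\<close>
definition spherical_deriv :: "(quat \<Rightarrow> quat) \<Rightarrow> quat \<Rightarrow> quat" where
  "spherical_deriv f q =
    (if q \<notin> \<real> then inverse (q - qcnj q) * (f q - f (qcnj q))
     else Lim (at q within - \<real>) (\<lambda>p. inverse (p - qcnj p) * (f p - f (qcnj p))))"


section \<open>Quaternionic reproducing kernel Hilbert spaces\<close>

definition hnorm :: "((quat \<Rightarrow> quat) \<Rightarrow> (quat \<Rightarrow> quat) \<Rightarrow> quat) \<Rightarrow> (quat \<Rightarrow> quat) \<Rightarrow> real" where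
  "hnorm ip f = sqrt (qre (ip f f))"

text \<open>
  Functions on \<open>\<Omega>\<close> are represented by their extensional representatives
  (equal to \<open>undefined\<close> outside \<open>\<Omega>\<close>), so that equality in \<open>H\<close> is equality on \<open>\<Omega>\<close>.
  The kernel function \<open>k\<^sub>w\<close> is \<open>k w\<close>.
\<close>
locale quat_rkhs =
  fixes \<Omega> :: "quat set"
    and H :: "(quat \<Rightarrow> quat) set"
    and ip :: "(quat \<Rightarrow> quat) \<Rightarrow> (quat \<Rightarrow> quat) \<Rightarrow> quat"
    and k :: "quat \<Rightarrow> quat \<Rightarrow> quat"
  assumes extensional_mem: "H \<subseteq> extensional \<Omega>"
    and zero_mem: "(\<lambda>q\<in>\<Omega>. 0) \<in> H"
    and add_mem: "\<lbrakk>f \<in> H; g \<in> H\<rbrakk> \<Longrightarrow> (\<lambda>q\<in>\<Omega>. f q + g q) \<in> H"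
    and scale_mem: "f \<in> H \<Longrightarrow> (\<lambda>q\<in>\<Omega>. f q * a) \<in> H"
    and ip_add: "\<lbrakk>f \<in> H; g \<in> H; h \<in> H\<rbrakk> \<Longrightarrow> ip (\<lambda>q\<in>\<Omega>. f q + g q) h = ip f h + ip g h"
    and ip_scale: "\<lbrakk>f \<in> H; g \<in> H\<rbrakk> \<Longrightarrow>
      ip (\<lambda>q\<in>\<Omega>. f q * a) (\<lambda>q\<in>\<Omega>. g q * b) = qcnj b * ip f g * a"
    and ip_cnj: "\<lbrakk>f \<in> H; g \<in> H\<rbrakk> \<Longrightarrow> ip g f = qcnj (ip f g)"
    and ip_nonneg: "f \<in> H \<Longrightarrow> 0 \<le> qre (ip f f)"
    and ip_definite: "\<lbrakk>f \<in> H; ip f f = 0\<rbrakk> \<Longrightarrow> f = (\<lambda>q\<in>\<Omega>. 0)"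
    and complete: "\<lbrakk>\<And>n. F n \<in> H;
        \<And>e. e > 0 \<Longrightarrow> \<exists>N::nat. \<forall>m\<ge>N. \<forall>n\<ge>N. hnorm ip (\<lambda>q\<in>\<Omega>. F m q - F n q) < e\<rbrakk>
      \<Longrightarrow> \<exists>f\<in>H. (\<lambda>n. hnorm ip (\<lambda>q\<in>\<Omega>. F n q - f q)) \<longlonglongrightarrow> 0"
    and kernel_mem: "w \<in> \<Omega> \<Longrightarrow> k w \<in> H"
    and kernel_nonzero: "w \<in> \<Omega> \<Longrightarrow> k w \<noteq> (\<lambda>q\<in>\<Omega>. 0)"
    and reproducing: "\<lbrakk>w \<in> \<Omega>; f \<in> H\<rbrakk> \<Longrightarrow> f w = ip f (k w)"

text \<open>For real \<open>w\<close> every slice contains \<open>w\<close>, and \<open>k w\<close> has to preserve all of them.\<close>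
definition slice_preserving_kernel :: "quat set \<Rightarrow> (quat \<Rightarrow> quat \<Rightarrow> quat) \<Rightarrow> bool" where
  "slice_preserving_kernel \<Omega> k \<longleftrightarrow>
    (\<forall>w\<in>\<Omega>. \<forall>I\<in>imag_units. w \<in> slice I \<longrightarrow> k w ` (\<Omega> \<inter> slice I) \<subseteq> slice I)"

text \<open>
  Squared length of the tangent vector \<open>d\<close> at \<open>w\<close> for the metric associated with the space.
\<close>
definition rkhs_metric_sq ::
  "quat set \<Rightarrow> ((quat \<Rightarrow> quat) \<Rightarrow> (quat \<Rightarrow> quat) \<Rightarrow> quat) \<Rightarrow> (quat \<Rightarrow> quat \<Rightarrow> quat) \<Rightarrow>
    quat \<Rightarrow> quat \<Rightarrow> real" where
  "rkhs_metric_sq \<Omega> ip k w d =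
    (let d1 = slice_proj (slice_unit w) d;
         d2 = d - d1;
         u = (\<lambda>q\<in>\<Omega>. qcnj (d1 * slice_deriv (k q) w + d2 * spherical_deriv (k q) w))
     in ((hnorm ip (k w))\<^sup>2 * (hnorm ip u)\<^sup>2 - (norm (ip (k w) u))\<^sup>2) / (hnorm ip (k w)) ^ 4)"

end

theory Submission
imports Defs "HOL-Complex_Analysis.Conformal_Mappings"
begin

text \<open>
  Write \<open>C\<close> and \<open>S\<close> for the functions \<open>q \<mapsto> qcnj (slice_deriv (k q) w)\<close> and
  \<open>q \<mapsto> qcnj (spherical_deriv (k q) w)\<close>. The function whose norm enters the metric is
  \<open>u = C * qcnj d1 + S * qcnj d2\<close>. Once \<open>C\<close> and \<open>S\<close> are known to lie in \<open>H\<close>, sesquilinearity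
  and the reproducing property give
  \<open>(norm u)\<^sup>2 = (norm C)\<^sup>2 (norm d1)\<^sup>2 + (norm S)\<^sup>2 (norm d2)\<^sup>2 + 2 Re (d2 * \<langle>C, S\<rangle> * qcnj d1)\<close>
  and \<open>\<langle>k w, u\<rangle> = d1 * slice_deriv (k w) w + d2 * spherical_deriv (k w) w\<close>
  (lemma \<open>rkhs_metric_sq_eq\<close>), and the theorem says that the mixed terms vanish.

  Let \<open>w\<close> be non-real. Because the kernel preserves slices, the two derivatives of \<open>k w\<close> at
  \<open>w\<close> lie in the slice \<open>L\<close> of \<open>w\<close>; so does \<open>\<langle>C, S\<rangle> = spherical_deriv C w\<close>, since \<open>C\<close> maps
  \<open>w\<close> and \<open>qcnj w\<close> into \<open>L\<close>. Multiplying an element of the orthogonal complement of \<open>L\<close> by an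
  element of \<open>L\<close> stays in the complement, which kills both mixed terms. If \<open>w\<close> is real, the
  spherical and the slice derivative agree there, so \<open>C = S\<close> and the metric is a multiple of
  \<open>(norm (d1 + d2))\<^sup>2\<close>. The vector \<open>d1 + d2\<close> is then split by \<open>slice_unit w\<close> along a slice that
  may differ from the given one, but both splittings are orthogonal.

  Two facts need analysis. The first is \<open>C \<in> H\<close>: on functions in \<open>H\<close>, the slice derivative at
  \<open>w\<close> is the limit of difference quotients in the real direction, hence of inner products with
  elements of \<open>H\<close>. Hilbert spaces are weakly sequentially complete (Banach-Steinhaus by Baire's
  theorem, then Riesz), which provides a representing element, and it coincides with \<open>C\<close>
  (\<open>slice_deriv_representer_mem\<close>). For \<open>S\<close> at a non-real point there is nothing to do, because
  \<open>S\<close> is a combination of \<open>k w\<close> and \<open>k (qcnj w)\<close>. The second is the equality of the two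
  derivatives at real points (\<open>spherical_deriv_eq_slice_deriv_on_reals\<close>). The spherical
  difference quotients of a regular function at \<open>x + y J\<close> are independent of \<open>J\<close> by the
  representation formula, which follows from the identity theorem for holomorphic functions; on
  one fixed slice their limit is computed by the mean value inequality.
\<close>

section \<open>Weak sequential completeness of Hilbert spaces\<close>

text \<open>
  A real Hilbert space on a carrier set, so that it applies to a set of functions which is not a
  type. All vector operations are instances of one binary combination, \<open>lin a f b g\<close> standing
  for \<open>a f + b g\<close>.
\<close>
locale real_hilbert_carrier =
  fixes H :: "'a set"
    and lin :: "real \<Rightarrow> 'a \<Rightarrow> real \<Rightarrow> 'a \<Rightarrow> 'a"
    and R :: "'a \<Rightarrow> 'a \<Rightarrow> real"
  assumes nonempty: "H \<noteq> {}"
    and lin_mem: "\<lbrakk>f \<in> H; g \<in> H\<rbrakk> \<Longrightarrow> lin a f b g \<in> H"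
    and R_lin: "\<lbrakk>f \<in> H; g \<in> H; h \<in> H\<rbrakk> \<Longrightarrow> R (lin a f b g) h = a * R f h + b * R g h"
    and R_sym: "\<lbrakk>f \<in> H; g \<in> H\<rbrakk> \<Longrightarrow> R f g = R g f"
    and R_nonneg: "f \<in> H \<Longrightarrow> 0 \<le> R f f"
    and R_separates: "\<lbrakk>f \<in> H; g \<in> H; R (lin 1 f (-1) g) (lin 1 f (-1) g) = 0\<rbrakk> \<Longrightarrow> f = g"
    and R_complete: "\<lbrakk>\<And>n. F n \<in> H;
        \<And>e. e > 0 \<Longrightarrow> \<exists>N::nat. \<forall>m\<ge>N. \<forall>n\<ge>N.
          sqrt (R (lin 1 (F m) (-1) (F n)) (lin 1 (F m) (-1) (F n))) < e\<rbrakk>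
      \<Longrightarrow> \<exists>f\<in>H. (\<lambda>n. sqrt (R (lin 1 (F n) (-1) f) (lin 1 (F n) (-1) f))) \<longlonglongrightarrow> 0"
begin

definition nrm :: "'a \<Rightarrow> real" where
  "nrm f = sqrt (R f f)"

text \<open>
  The value outside the carrier is fixed because a metric has to be nonnegative and symmetric on
  the whole type.
\<close>
definition hdist :: "'a \<Rightarrow> 'a \<Rightarrow> real" where
  "hdist f g = (if f \<in> H \<and> g \<in> H then nrm (lin 1 f (-1) g) else 0)"

lemma R_lin_right:
  "\<lbrakk>f \<in> H; g \<in> H; h \<in> H\<rbrakk> \<Longrightarrow> R h (lin a f b g) = a * R h f + b * R h g"
  by (metis R_lin R_sym lin_mem)

lemmas R_expand = R_lin R_lin_right lin_mem

lemma nrm_nonneg: "f \<in> H \<Longrightarrow> 0 \<le> nrm f"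
  by (simp add: nrm_def R_nonneg)

lemma nrm_square: "f \<in> H \<Longrightarrow> (nrm f)\<^sup>2 = R f f"
  by (simp add: nrm_def R_nonneg)

lemma hdist_eq: "\<lbrakk>f \<in> H; g \<in> H\<rbrakk> \<Longrightarrow> hdist f g = nrm (lin 1 f (-1) g)"
  by (simp add: hdist_def)

lemma hdist_square:
  "\<lbrakk>f \<in> H; g \<in> H\<rbrakk> \<Longrightarrow> (hdist f g)\<^sup>2 = R f f - 2 * R f g + R g g"
  by (simp add: hdist_eq nrm_square R_expand R_sym[of g f])

lemma Cauchy_Schwarz:
  assumes "f \<in> H" "g \<in> H"
  shows "\<bar>R f g\<bar> \<le> nrm f * nrm g"
proof -
  have "(R f g)\<^sup>2 \<le> R f f * R g g"
  proof (cases "R g g = 0")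
    case True
    \<comment> \<open>\<open>s \<mapsto> R (f + s g) (f + s g)\<close> is then affine and nonnegative, so its slope vanishes.\<close>
    have "R f g = 0"
    proof (rule ccontr)
      assume "R f g \<noteq> 0"
      define s where "s = - (R f f + 1) / (2 * R f g)"
      have "0 \<le> R (lin 1 f s g) (lin 1 f s g)"
        using assms by (intro R_nonneg lin_mem)
      also have "\<dots> = R f f + 2 * s * R f g"
        using assms True by (simp add: R_expand R_sym[of g f] algebra_simps)
      also have "\<dots> = -1"
        using \<open>R f g \<noteq> 0\<close> by (simp add: s_def field_simps)
      finally show False by simp
    qed
    then show ?thesis using True by simp
  next
    case False
    then have pos: "R g g > 0" using R_nonneg[OF assms(2)] by simp
    have "0 \<le> R (lin (R g g) f (- R f g) g) (lin (R g g) f (- R f g) g)"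
      using assms by (intro R_nonneg lin_mem)
    also have "\<dots> = R g g * (R f f * R g g - (R f g)\<^sup>2)"
      using assms by (simp add: R_expand R_sym[of g f] algebra_simps power2_eq_square)
    finally show ?thesis
      using pos by (simp add: zero_le_mult_iff)
  qed
  then have "\<bar>R f g\<bar>\<^sup>2 \<le> (nrm f * nrm g)\<^sup>2"
    using assms by (simp add: power_mult_distrib nrm_square)
  then show ?thesis
    by (rule power2_le_imp_le) (use assms in \<open>simp add: nrm_nonneg\<close>)
qed

lemma hdist_R:
  assumes "f \<in> H" "g \<in> H" "h \<in> H"
  shows "\<bar>R f h - R g h\<bar> \<le> hdist f g * nrm h"
  using Cauchy_Schwarz[OF lin_mem[OF assms(1,2)] assms(3), of 1 "-1"] assms
  by (simp add: R_lin hdist_eq)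

sublocale Metric_space H hdist
proof
  fix x y z
  show "0 \<le> hdist x y"
    by (simp add: hdist_def nrm_nonneg lin_mem)
  show "hdist x y = hdist y x"
  proof (cases "x \<in> H \<and> y \<in> H")
    case True
    then have "(hdist x y)\<^sup>2 = (hdist y x)\<^sup>2"
      by (simp add: hdist_square R_sym)
    then show ?thesis
      by (simp add: hdist_def nrm_nonneg lin_mem split: if_splits)
  qed (auto simp: hdist_def)
  show "hdist x y = 0 \<longleftrightarrow> x = y" if "x \<in> H" "y \<in> H"
  proof
    assume "hdist x y = 0"
    then have "R (lin 1 x (-1) y) (lin 1 x (-1) y) = 0"
      using that by (simp add: hdist_eq nrm_def)
    then show "x = y" using that by (rule R_separates[rotated -1])
  next
    assume "x = y"
    then have "(hdist x y)\<^sup>2 = 0"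
      using that by (subst hdist_square) auto
    then show "hdist x y = 0" by simp
  qed
  show "hdist x z \<le> hdist x y + hdist y z" if "x \<in> H" "y \<in> H" "z \<in> H"
  proof -
    let ?u = "lin 1 x (-1) y" and ?v = "lin 1 y (-1) z"
    have mem: "?u \<in> H" "?v \<in> H" using that by (simp_all add: lin_mem)
    have "(hdist x z)\<^sup>2 = R ?u ?u + 2 * R ?u ?v + R ?v ?v"
      using that by (simp add: hdist_square R_expand R_sym[of y x] R_sym[of z x] R_sym[of z y])
    also have "\<dots> \<le> (nrm ?u)\<^sup>2 + 2 * (nrm ?u * nrm ?v) + (nrm ?v)\<^sup>2"
      using Cauchy_Schwarz[OF mem] mem by (simp add: nrm_square)
    also have "\<dots> = (hdist x y + hdist y z)\<^sup>2"
      using that by (simp add: hdist_eq power2_sum)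
    finally show ?thesis
      by (rule power2_le_imp_le) (use that mem in \<open>simp add: hdist_eq nrm_nonneg\<close>)
  qed
qed

lemma Cauchy_has_limit:
  assumes "\<And>n. F n \<in> H"
    and "\<And>e. e > 0 \<Longrightarrow> \<exists>N::nat. \<forall>m\<ge>N. \<forall>n\<ge>N. hdist (F m) (F n) < e"
  shows "\<exists>x\<in>H. (\<lambda>n. hdist (F n) x) \<longlonglongrightarrow> 0"
proof -
  have "\<exists>x\<in>H. (\<lambda>n. sqrt (R (lin 1 (F n) (-1) x) (lin 1 (F n) (-1) x))) \<longlonglongrightarrow> 0"
    by (rule R_complete) (use assms in \<open>simp_all add: hdist_eq nrm_def\<close>)
  then show ?thesis
    using assms(1) by (auto simp: hdist_eq nrm_def)
qed

lemma hilbert_mcomplete: "mcomplete"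
  unfolding mcomplete_def
proof (intro allI impI)
  fix \<sigma> assume "MCauchy \<sigma>"
  then have mem: "\<And>n. \<sigma> n \<in> H"
    and C: "\<And>e. e > 0 \<Longrightarrow> \<exists>N. \<forall>m\<ge>N. \<forall>n\<ge>N. hdist (\<sigma> m) (\<sigma> n) < e"
    unfolding MCauchy_def by (blast, meson)
  from Cauchy_has_limit[OF mem C] obtain x where "x \<in> H" "(\<lambda>n. hdist (\<sigma> n) x) \<longlonglongrightarrow> 0"
    by blast
  then show "\<exists>x. limitin mtopology \<sigma> x sequentially"
    using mem by (auto simp: limitin_metric_dist_null)
qed

text \<open>
  The uniform boundedness principle. By Baire's theorem, one of the closed sets on which all
  functionals \<open>R _ (D n)\<close> are bounded by a common integer contains a ball; moving from the centre
  of the ball in the direction of \<open>D n\<close> bounds \<open>nrm (D n)\<close> itself.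
\<close>
lemma weakly_bounded_imp_bounded:
  fixes D :: "nat \<Rightarrow> 'a"
  assumes D: "\<And>n. D n \<in> H"
    and bdd: "\<And>f. f \<in> H \<Longrightarrow> \<exists>B. \<forall>n. \<bar>R f (D n)\<bar> \<le> B"
  shows "\<exists>B. \<forall>n. nrm (D n) \<le> B"
proof -
  define E where "E K = {f\<in>H. \<forall>n. \<bar>R f (D n)\<bar> \<le> real K}" for K :: nat
  have closed: "closedin mtopology (E K)" for K
    unfolding closedin_metric
  proof (intro conjI allI impI)
    show "E K \<subseteq> H" by (auto simp: E_def)
    fix f assume f: "f \<in> H - E K"
    then obtain n where n: "\<bar>R f (D n)\<bar> > real K" by (auto simp: E_def not_le)
    define r where "r = (\<bar>R f (D n)\<bar> - real K) / (nrm (D n) + 1)"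
    have N: "nrm (D n) \<ge> 0" using D by (rule nrm_nonneg)
    have "r > 0" using n N by (simp add: r_def)
    moreover have "disjnt (E K) (mball f r)"
    proof (rule ccontr)
      assume "\<not> ?thesis"
      then obtain g where g: "g \<in> H" "\<bar>R g (D n)\<bar> \<le> real K" "hdist f g < r"
        by (force simp: disjnt_def E_def)
      have "\<bar>R f (D n)\<bar> - real K \<le> \<bar>R f (D n) - R g (D n)\<bar>" using g by linarith
      also have "\<dots> \<le> hdist f g * nrm (D n)" using f g D by (intro hdist_R) auto
      also have "\<dots> \<le> r * nrm (D n)" using g N by (intro mult_right_mono) auto
      also have "\<dots> < r * (nrm (D n) + 1)" using \<open>r > 0\<close> by simp
      also have "\<dots> = \<bar>R f (D n)\<bar> - real K" using N by (simp add: r_def)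
      finally show False by simp
    qed
    ultimately show "\<exists>r>0. disjnt (E K) (mball f r)" by blast
  qed
  have cover: "\<Union>(range E) = H"
  proof (intro equalityI subsetI)
    fix f assume "f \<in> H"
    with bdd obtain B where B: "\<And>n. \<bar>R f (D n)\<bar> \<le> B" by blast
    obtain K where "B \<le> real K" using real_arch_simple by blast
    then have "\<bar>R f (D n)\<bar> \<le> real K" for n using B[of n] by linarith
    then show "f \<in> \<Union>(range E)" using \<open>f \<in> H\<close> by (auto simp: E_def)
  qed (auto simp: E_def)
  have "\<exists>K. mtopology interior_of (E K) \<noteq> {}"
  proof (rule ccontr)
    assume "\<nexists>K. mtopology interior_of (E K) \<noteq> {}"
    then have "mtopology interior_of \<Union>(range E) = {}"
      using closed by (intro metric_Baire_category_alt hilbert_mcomplete) auto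
    moreover have "mtopology interior_of H = H"
      using interior_of_topspace[of mtopology] by simp
    ultimately show False using cover nonempty by simp
  qed
  then obtain K f where "f \<in> mtopology interior_of (E K)" by blast
  then obtain T where T: "openin mtopology T" "f \<in> T" "T \<subseteq> E K"
    by (auto simp: interior_of_def)
  then obtain r where r: "r > 0" "mball f r \<subseteq> E K"
    unfolding openin_mtopology by blast
  have f: "f \<in> E K" "f \<in> H" using T by (auto simp: E_def)
  have "nrm (D n) \<le> 4 * real K / r" for n
  proof (cases "nrm (D n) = 0")
    case True
    then show ?thesis using r by simp
  next
    case False
    then have N: "nrm (D n) > 0" using nrm_nonneg[OF D[of n]] by simp
    \<comment> \<open>With this step, \<open>g\<close> has distance \<open>r / 2\<close> from \<open>f\<close>.\<close>
    define s where "s = r / (2 * nrm (D n))"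
    define g where "g = lin 1 f s (D n)"
    have gH: "g \<in> H" using f D by (simp add: g_def lin_mem)
    have "(hdist f g)\<^sup>2 = s\<^sup>2 * R (D n) (D n)"
      unfolding hdist_square[OF f(2) gH] using f D
      by (simp add: g_def R_expand R_sym[of "D n" f] algebra_simps power2_eq_square)
    also have "\<dots> = (r / 2)\<^sup>2"
      using N by (simp add: s_def nrm_square[OF D, symmetric] field_simps)
    finally have "hdist f g = r / 2" using r by simp
    then have "g \<in> E K" using r f gH by auto
    then have "\<bar>R f (D n) + s * R (D n) (D n)\<bar> \<le> real K"
      using f D by (simp add: E_def g_def R_expand)
    moreover have "\<bar>R f (D n)\<bar> \<le> real K" using f by (simp add: E_def)
    ultimately have "s * R (D n) (D n) \<le> 2 * real K" by linarith
    moreover have "s * R (D n) (D n) = r * nrm (D n) / 2"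
      using N by (simp add: s_def nrm_square[OF D, symmetric] power2_eq_square)
    ultimately show ?thesis using r by (simp add: field_simps)
  qed
  then show ?thesis by blast
qed

text \<open>
  The representing vector minimises \<open>J f = R f f - 2 l f\<close>. A minimising sequence is Cauchy by the
  parallelogram law.
\<close>
lemma Riesz_representation:
  assumes l_lin: "\<And>f g a b. \<lbrakk>f \<in> H; g \<in> H\<rbrakk> \<Longrightarrow> l (lin a f b g) = a * l f + b * l g"
    and l_bdd: "\<And>f. f \<in> H \<Longrightarrow> \<bar>l f\<bar> \<le> B * nrm f"
  shows "\<exists>x\<in>H. \<forall>h\<in>H. R h x = l h"
proof -
  define J where "J f = R f f - 2 * l f" for f
  have J_lower: "J f \<ge> - B\<^sup>2" if "f \<in> H" for f
  proof -
    have "0 \<le> (nrm f - B)\<^sup>2" by simp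
    then show ?thesis
      using l_bdd[OF that] nrm_square[OF that] by (simp add: J_def power2_diff algebra_simps)
  qed
  define m where "m = Inf (J ` H)"
  have bb: "bdd_below (J ` H)" using J_lower by (intro bdd_belowI2)
  have m_le: "m \<le> J f" if "f \<in> H" for f
    unfolding m_def using that bb by (intro cInf_lower) auto
  have "\<exists>f\<in>H. J f < m + inverse (real (Suc n))" for n
    using cInf_lessD[of "J ` H" "m + inverse (real (Suc n))"] nonempty by (auto simp: m_def)
  then obtain F where F: "\<And>n. F n \<in> H" "\<And>n. J (F n) < m + inverse (real (Suc n))"
    by metis
  have dist_bound: "(hdist f g)\<^sup>2 \<le> 2 * (J f - m) + 2 * (J g - m)" if "f \<in> H" "g \<in> H" for f g
  proof -
    have "m \<le> J (lin (1/2) f (1/2) g)" using that by (intro m_le lin_mem)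
    also have "\<dots> = (J f + J g) / 2 - (hdist f g)\<^sup>2 / 4"
      using that by (simp add: J_def hdist_square R_expand l_lin R_sym[of g f] field_simps)
    finally show ?thesis by (simp add: field_simps)
  qed
  have "\<exists>x\<in>H. (\<lambda>n. hdist (F n) x) \<longlonglongrightarrow> 0"
  proof (rule Cauchy_has_limit[OF F(1)])
    fix e :: real assume "e > 0"
    then obtain N where N: "inverse (real (Suc N)) < e\<^sup>2 / 4"
      using reals_Archimedean[of "e\<^sup>2 / 4"] by auto
    have "hdist (F i) (F j) < e" if "i \<ge> N" "j \<ge> N" for i j
    proof -
      have mono: "inverse (real (Suc n)) \<le> inverse (real (Suc N))" if "n \<ge> N" for n
        using that by (intro le_imp_inverse_le) auto
      have excess: "J (F n) - m \<le> inverse (real (Suc N))" if "n \<ge> N" for n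
        using F(2)[of n] mono[OF that] by linarith
      have "(hdist (F i) (F j))\<^sup>2 \<le> 2 * (J (F i) - m) + 2 * (J (F j) - m)"
        by (rule dist_bound[OF F(1) F(1)])
      also have "\<dots> \<le> 2 * inverse (real (Suc N)) + 2 * inverse (real (Suc N))"
        using that by (intro add_mono mult_left_mono excess) auto
      also have "\<dots> < e\<^sup>2" using N by simp
      finally have "(hdist (F i) (F j))\<^sup>2 < e\<^sup>2" .
      then show ?thesis by (rule power2_less_imp_less) (use \<open>e > 0\<close> in simp)
    qed
    then show "\<exists>N. \<forall>m\<ge>N. \<forall>n\<ge>N. hdist (F m) (F n) < e" by blast
  qed
  then obtain x where x: "x \<in> H" "(\<lambda>n. hdist (F n) x) \<longlonglongrightarrow> 0" by blast
  have "R h x = l h" if h: "h \<in> H" for h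
  proof -
    define c where "c n = R (F n) h - l h" for n
    define P where "P = R h h"
    have P: "P \<ge> 0" using h by (simp add: P_def R_nonneg)
    have c_small: "(c n)\<^sup>2 \<le> (P + 1) * inverse (real (Suc n))" for n
    proof -
      \<comment> \<open>Varying the almost-minimiser \<open>F n\<close> in direction \<open>h\<close> lowers \<open>J\<close> by about \<open>(c n)\<^sup>2 / P\<close>,
        so \<open>c n\<close> must be small; \<open>P + 1\<close> avoids division by zero.\<close>
      define t where "t = - c n / (P + 1)"
      have "m \<le> J (lin 1 (F n) t h)" using F h by (intro m_le lin_mem)
      also have "\<dots> = J (F n) + 2 * t * c n + t\<^sup>2 * P"
        using F(1)[of n] h
        by (simp add: J_def R_expand l_lin R_sym[of h "F n"] c_def P_def algebra_simps
            power2_eq_square)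
      also have "\<dots> \<le> J (F n) + 2 * t * c n + t\<^sup>2 * (P + 1)"
        by (simp add: mult_left_mono)
      also have "t\<^sup>2 * (P + 1) = - t * c n"
        using P by (simp add: t_def power2_eq_square)
      also have "J (F n) + 2 * t * c n + - t * c n = J (F n) - (c n)\<^sup>2 / (P + 1)"
        by (simp add: t_def power2_eq_square)
      finally have "(c n)\<^sup>2 / (P + 1) \<le> inverse (real (Suc n))" using F(2)[of n] by linarith
      then show ?thesis using P by (simp add: field_simps)
    qed
    have "(\<lambda>n. (c n)\<^sup>2) \<longlonglongrightarrow> 0"
    proof (rule Lim_null_comparison)
      show "(\<lambda>n. (P + 1) * inverse (real (Suc n))) \<longlonglongrightarrow> 0"
        using tendsto_mult_right_zero[OF LIMSEQ_inverse_real_of_nat] by blast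
      show "\<forall>\<^sub>F n in sequentially. norm ((c n)\<^sup>2) \<le> (P + 1) * inverse (real (Suc n))"
        using c_small by (intro always_eventually) simp
    qed
    then have "c \<longlonglongrightarrow> 0" by simp
    then have lim1: "(\<lambda>n. R (F n) h) \<longlonglongrightarrow> l h"
      unfolding c_def using Lim_null by blast
    have "(\<lambda>n. R (F n) h - R x h) \<longlonglongrightarrow> 0"
    proof (rule Lim_null_comparison)
      show "(\<lambda>n. hdist (F n) x * nrm h) \<longlonglongrightarrow> 0"
        using x(2) by (rule tendsto_mult_left_zero)
    qed (use F x h in \<open>auto intro!: always_eventually hdist_R\<close>)
    then have "(\<lambda>n. R (F n) h) \<longlonglongrightarrow> R x h" using Lim_null by blast
    with lim1 have "R x h = l h" using LIMSEQ_unique by blast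
    then show ?thesis using x h by (simp add: R_sym)
  qed
  then show ?thesis using x by blast
qed

text \<open>
  The pointwise limit of the functionals \<open>R _ (D n)\<close> is linear, and it is bounded since the
  \<open>D n\<close> are bounded in norm; Riesz represents it.
\<close>
theorem weakly_sequentially_complete:
  fixes D :: "nat \<Rightarrow> 'a"
  assumes D: "\<And>n. D n \<in> H"
    and lim: "\<And>f. f \<in> H \<Longrightarrow> (\<lambda>n. R f (D n)) \<longlonglongrightarrow> l f"
  shows "\<exists>x\<in>H. \<forall>f\<in>H. R f x = l f"
proof -
  have "\<exists>B. \<forall>n. \<bar>R f (D n)\<bar> \<le> B" if "f \<in> H" for f
    using Bseq_bdd_above[OF convergent_imp_Bseq[OF convergentI[OF tendsto_rabs[OF lim[OF that]]]]]
    by (auto simp: bdd_above_def)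
  from weakly_bounded_imp_bounded[OF D this] obtain B where B: "\<And>n. nrm (D n) \<le> B" by blast
  show ?thesis
  proof (rule Riesz_representation)
    fix f g a b assume fg: "f \<in> H" "g \<in> H"
    then have "(\<lambda>n. R (lin a f b g) (D n)) \<longlonglongrightarrow> a * l f + b * l g"
      using D by (simp add: R_lin) (intro tendsto_intros lim)
    with lim[OF lin_mem[OF fg]] show "l (lin a f b g) = a * l f + b * l g"
      using LIMSEQ_unique by blast
  next
    fix f assume f: "f \<in> H"
    have "\<bar>R f (D n)\<bar> \<le> B * nrm f" for n
    proof -
      have "\<bar>R f (D n)\<bar> \<le> nrm f * nrm (D n)" using f D by (rule Cauchy_Schwarz)
      also have "\<dots> \<le> nrm f * B" using f B by (intro mult_left_mono nrm_nonneg)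
      finally show ?thesis by (simp add: mult.commute)
    qed
    then show "\<bar>l f\<bar> \<le> B * nrm f"
      using LIMSEQ_le_const2[OF tendsto_rabs[OF lim[OF f]]] by blast
  qed
qed

end


section \<open>Slices and their coordinates\<close>

lemma imag_unit_facts:
  assumes "I \<in> imag_units"
  shows "qre I = 0" "I \<bullet> I = 1" "I * I = -1" "norm I = 1" "I \<noteq> 0" "- I \<in> imag_units"
    "inverse I = - I" "qcnj I = - I"
proof -
  show I: "qre I = 0" "I \<bullet> I = 1" "I * I = -1"
    using assms imag_units_iff[of I] by (auto simp: imag_units_def power2_eq_square)
  show n: "norm I = 1" using I(2) by (simp add: norm_eq_sqrt_inner)
  then show "I \<noteq> 0" by auto
  show "- I \<in> imag_units" using assms by (simp add: imag_units_def)
  show "inverse I = - I" by (rule inverse_unique) (simp add: I)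
  show "qcnj I = - I" using I by (simp add: quat_eq_iff)
qed

lemma slice_coords:
  assumes "I \<in> imag_units" "w \<in> slice I"
  shows "w = of_real (qre w) + of_real (w \<bullet> I) * I"
proof -
  have "0 \<in> orthogonal_comp (slice I)"
    by (simp add: orthogonal_comp_def orthogonal_def)
  from slice_proj_decomp[OF assms this] show ?thesis
    by (simp add: slice_proj_def)
qed

text \<open>
  The isometric embedding of the complex plane onto the slice of \<open>I\<close>; it moves questions about
  regular functions on a slice into complex analysis.
\<close>
definition slice_point :: "quat \<Rightarrow> complex \<Rightarrow> quat" where
  "slice_point I z = of_real (Re z) + of_real (Im z) * I"

lemma slice_point_Complex: "slice_point I (Complex x y) = of_real x + of_real y * I"
  by (simp add: slice_point_def)

lemma dist_slice_point:
  assumes "I \<in> imag_units"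
  shows "dist (slice_point I a) (slice_point I b) = dist a b"
proof -
  have "(norm (of_real s + of_real t * I))\<^sup>2 = s\<^sup>2 + t\<^sup>2" for s t
  proof -
    have "(norm (of_real s + of_real t * I))\<^sup>2 =
        s\<^sup>2 * ((1::quat) \<bullet> 1) + 2 * s * t * (1 \<bullet> I) + t\<^sup>2 * (I \<bullet> I)"
      unfolding norm_quat_square of_real_def
      by (simp add: inner_add_left inner_add_right inner_commute[of I 1] power2_eq_square
          algebra_simps)
    then show ?thesis
      using imag_unit_facts[OF assms] by (simp add: inner_quat_def)
  qed
  from this[of "Re (a - b)" "Im (a - b)"]
  have "(norm (slice_point I a - slice_point I b))\<^sup>2 = (cmod (a - b))\<^sup>2"
    unfolding cmod_power2 by (simp add: slice_point_def algebra_simps)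
  then show ?thesis by (simp add: dist_norm)
qed

lemma continuous_on_slice_point: "continuous_on A (slice_point I)"
  unfolding slice_point_def by (intro continuous_intros)

lemma open_slice_preimage: "open \<Omega> \<Longrightarrow> open {z. slice_point I z \<in> \<Omega>}"
  using open_vimage[OF _ continuous_on_slice_point, of \<Omega> I] by (simp add: vimage_def)

lemma quat_eq_slice_point: "\<exists>J\<in>imag_units. \<exists>z. q = slice_point J z"
proof -
  define v where "v = q - of_real (qre q)"
  have re: "qre v = 0" by (simp add: v_def)
  show ?thesis
  proof (cases "v = 0")
    case True
    moreover have "Quat 0 1 0 0 \<in> imag_units" by (simp add: imag_units_iff inner_quat_def)
    ultimately show ?thesis
      by (intro bexI[of _ "Quat 0 1 0 0"] exI[of _ "Complex (qre q) 0"])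
        (simp_all add: slice_point_def v_def)
  next
    case False
    define J where "J = v /\<^sub>R norm v"
    have "J \<in> imag_units"
      using False re by (simp add: imag_units_iff J_def norm_quat_square[symmetric]
          power2_eq_square)
    moreover have "q = slice_point J (Complex (qre q) (norm v))"
      using False by (simp add: slice_point_def J_def v_def of_real_def)
    ultimately show ?thesis by blast
  qed
qed

lemma slice_unit:
  shows "slice_unit w \<in> imag_units" "w \<in> slice (slice_unit w)"
proof -
  have "\<exists>I. I \<in> imag_units \<and> w \<in> slice I"
    using quat_eq_slice_point[of w] by (auto simp: slice_point_def slice_def)
  from someI_ex[OF this] show "slice_unit w \<in> imag_units" "w \<in> slice (slice_unit w)"
    by (simp_all add: slice_unit_def)
qed

section \<open>Derivatives of slice regular functions\<close>

lemma slice_regularD: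
  assumes "slice_regular f \<Omega>" "I \<in> imag_units" "of_real x + of_real y * I \<in> \<Omega>"
  shows "((\<lambda>t. f (of_real t + of_real y * I)) has_vector_derivative slice_dx I f x y) (at x)"
    and "((\<lambda>t. f (of_real x + of_real t * I)) has_vector_derivative slice_dy I f x y) (at y)"
    and "slice_dy I f x y = I * slice_dx I f x y"
proof -
  from assms have *: "(\<lambda>t. f (of_real t + of_real y * I)) differentiable (at x)"
    "(\<lambda>t. f (of_real x + of_real t * I)) differentiable (at y)"
    "(1/2) *\<^sub>R (slice_dx I f x y + I * slice_dy I f x y) = 0"
    by (auto simp: slice_regular_def)
  show "((\<lambda>t. f (of_real t + of_real y * I)) has_vector_derivative slice_dx I f x y) (at x)"
    "((\<lambda>t. f (of_real x + of_real t * I)) has_vector_derivative slice_dy I f x y) (at y)"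
    using *(1,2) by (simp_all add: slice_dx_def slice_dy_def vector_derivative_works)
  have "slice_dx I f x y = - (I * slice_dy I f x y)"
    using *(3) by (simp add: eq_neg_iff_add_eq_0)
  then show "slice_dy I f x y = I * slice_dx I f x y"
    using imag_unit_facts[OF assms(2)] by (simp flip: mult.assoc)
qed

lemma slice_deriv_eq_dx:
  assumes "slice_regular f \<Omega>" "w \<in> \<Omega>"
  shows "slice_deriv f w = slice_dx (slice_unit w) f (qre w) (w \<bullet> slice_unit w)"
proof -
  let ?I = "slice_unit w"
  note I = slice_unit[of w]
  have dy: "slice_dy ?I f (qre w) (w \<bullet> ?I) = ?I * slice_dx ?I f (qre w) (w \<bullet> ?I)"
    using assms I slice_coords[OF I] by (intro slice_regularD(3)[OF assms(1)]) auto
  show ?thesis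
    using imag_unit_facts(3)[OF I(1)]
    by (simp add: slice_deriv_def Let_def dy flip: mult.assoc scaleR_2)
qed

text \<open>
  The Cauchy-Riemann equation turns \<open>(\<partial>\<^sub>x - I \<partial>\<^sub>y) / 2\<close> into \<open>\<partial>\<^sub>x\<close>. The slice derivative thus
  becomes a limit of combinations of point evaluations, which a reproducing kernel can represent.
\<close>
lemma slice_deriv_is_real_direction_derivative:
  assumes "slice_regular f \<Omega>" "w \<in> \<Omega>"
  shows "((\<lambda>t. (1/t) *\<^sub>R (f (w + of_real t) - f w)) \<longlongrightarrow> slice_deriv f w) (at 0)"
proof -
  let ?I = "slice_unit w"
  define x y where "x = qre w" and "y = w \<bullet> ?I"
  note I = slice_unit[of w]
  have w: "w = of_real x + of_real y * ?I"
    using slice_coords[OF I] by (simp add: x_def y_def)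
  let ?g = "\<lambda>t. f (of_real t + of_real y * ?I)"
  let ?D = "slice_deriv f w"
  have g: "?g (x + t) = f (w + of_real t)" "?g x = f w" for t
    by (simp_all add: w[symmetric]) (subst (2) w, simp add: algebra_simps)
  have "(?g has_vector_derivative ?D) (at x)"
    using slice_regularD(1)[OF assms(1) I(1), of x y] assms w
    by (simp add: slice_deriv_eq_dx[OF assms] x_def y_def)
  then have "(\<lambda>t. norm (?g (x + t) - ?g x - t *\<^sub>R ?D) / norm t) \<midarrow>0\<rightarrow> 0"
    by (simp add: has_vector_derivative_def has_derivative_at)
  then have "(\<lambda>t. norm (f (w + of_real t) - f w - t *\<^sub>R ?D) / norm t) \<midarrow>0\<rightarrow> 0"
    by (simp only: g)
  then have "(\<lambda>t. (1/t) *\<^sub>R (f (w + of_real t) - f w) - ?D) \<midarrow>0\<rightarrow> 0"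
  proof (rule Lim_null_comparison[rotated])
    have "norm ((1/t) *\<^sub>R (f (w + of_real t) - f w) - ?D) =
        norm (f (w + of_real t) - f w - t *\<^sub>R ?D) / norm t" if "t \<noteq> 0" for t
    proof -
      have "(1/t) *\<^sub>R (f (w + of_real t) - f w) - ?D =
          (1/t) *\<^sub>R (f (w + of_real t) - f w - t *\<^sub>R ?D)"
        using that by (simp add: scaleR_diff_right)
      then show ?thesis by simp
    qed
    then show "\<forall>\<^sub>F t in at 0. norm ((1/t) *\<^sub>R (f (w + of_real t) - f w) - ?D) \<le>
        norm (f (w + of_real t) - f w - t *\<^sub>R ?D) / norm t"
      by (auto simp: eventually_at intro!: exI[of _ 1])
  qed
  then show ?thesis by (rule LIM_zero_cancel)
qed

section \<open>The representation formula near real points\<close>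

text \<open>
  A real-linear map that intertwines left multiplication by \<open>I\<close> with multiplication by \<open>\<i>\<close> turns
  the regularity equation on the slice of \<open>I\<close> into the Cauchy-Riemann equation. Continuity of the
  partial derivatives supplies total differentiability.
\<close>
lemma slice_component_holomorphic:
  fixes L :: "quat \<Rightarrow> complex"
  assumes f: "slice_regular f \<Omega>" and "open \<Omega>" and I: "I \<in> imag_units"
    and L: "bounded_linear L" and L_I: "\<And>v. L (I * v) = \<i> * L v"
  shows "(\<lambda>z. L (f (slice_point I z))) holomorphic_on {z. slice_point I z \<in> \<Omega>}"
proof -
  interpret L: bounded_linear L by (rule L)
  let ?D = "{z. slice_point I z \<in> \<Omega>}"
  have "\<exists>c. ((\<lambda>z. L (f (slice_point I z))) has_field_derivative c) (at z0)" if z0: "z0 \<in> ?D" for z0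
  proof -
    define x0 y0 where "x0 = Re z0" and "y0 = Im z0"
    define dx dy where "dx = slice_dx I f" and "dy = slice_dy I f"
    define G where "G x y = L (f (of_real x + of_real y * I))" for x y
    obtain e where e: "e > 0" "ball z0 e \<subseteq> ?D"
      using open_contains_ball[THEN iffD1, OF open_slice_preimage[OF \<open>open \<Omega>\<close>], rule_format, OF z0]
      by blast
    define X Y where "X = ball x0 (e/2)" and "Y = ball y0 (e/2)"
    have box: "of_real x + of_real y * I \<in> \<Omega>" if "x \<in> X" "y \<in> Y" for x y
    proof -
      have "dist (Complex x y) z0 \<le> \<bar>x - x0\<bar> + \<bar>y - y0\<bar>"
        using cmod_le[of "Complex x y - z0"] by (simp add: dist_norm x0_def y0_def)
      also have "\<dots> < e"
        using that by (simp add: X_def Y_def dist_real_def abs_minus_commute)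
      finally have "Complex x y \<in> ?D" using e by (auto simp: dist_commute)
      then show ?thesis by (simp add: slice_point_Complex)
    qed
    have mem: "x0 \<in> X" "y0 \<in> Y" using e by (simp_all add: X_def Y_def)
    have "((\<lambda>(x, y). G x y) has_derivative
        (\<lambda>(tx, ty). tx *\<^sub>R L (dx x0 y0) + blinfun_scaleR_left (L (dy x0 y0)) ty))
        (at (x0, y0) within X \<times> Y)"
    proof (rule has_derivative_partialsI)
      have "((\<lambda>x. f (of_real x + of_real y0 * I)) has_derivative (\<lambda>t. t *\<^sub>R dx x0 y0)) (at x0 within X)"
        using slice_regularD(1)[OF f I box[OF mem]]
        by (auto simp: has_vector_derivative_def dx_def intro: has_derivative_at_withinI)
      from L.has_derivative[OF this] show
        "((\<lambda>x. G x y0) has_derivative (\<lambda>tx. tx *\<^sub>R L (dx x0 y0))) (at x0 within X)"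
        by (simp add: G_def L.scaleR)
    next
      fix x y assume xy: "x \<in> X" "y \<in> Y"
      have "((\<lambda>y. f (of_real x + of_real y * I)) has_derivative (\<lambda>t. t *\<^sub>R dy x y)) (at y within Y)"
        using slice_regularD(2)[OF f I box[OF xy]]
        by (auto simp: has_vector_derivative_def dy_def intro: has_derivative_at_withinI)
      from L.has_derivative[OF this] show
        "(G x has_derivative blinfun_apply (blinfun_scaleR_left (L (dy x y)))) (at y within Y)"
        by (simp add: G_def[abs_def] L.scaleR)
    next
      have "continuous_on (X \<times> Y) (\<lambda>(x, y). dy x y)"
      proof (rule continuous_on_subset)
        show "continuous_on {(x, y). of_real x + of_real y * I \<in> \<Omega>} (\<lambda>(x, y). dy x y)"
          using f I by (simp add: slice_regular_def dy_def)
      qed (use box in auto)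
      then have "continuous_on (X \<times> Y) (\<lambda>p. blinfun_scaleR_left (L (case p of (x, y) \<Rightarrow> dy x y)))"
        by (intro bounded_linear.continuous_on[OF bounded_linear_blinfun_scaleR_left]
            L.continuous_on)
      then show "continuous (at (x0, y0) within X \<times> Y) (\<lambda>(x, y). blinfun_scaleR_left (L (dy x y)))"
        using mem by (simp add: continuous_on_eq_continuous_within case_prod_unfold)
    qed (use mem in \<open>auto simp: Y_def\<close>)
    moreover have "at (x0, y0) within X \<times> Y = at (x0, y0)"
      using mem by (intro at_within_open open_Times) (auto simp: X_def Y_def)
    ultimately have total: "((\<lambda>(x, y). G x y) has_derivative
        (\<lambda>(tx, ty). tx *\<^sub>R L (dx x0 y0) + ty *\<^sub>R L (dy x0 y0))) (at (Re z0, Im z0))"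
      by (simp add: x0_def y0_def)
    have "((\<lambda>z. (Re z, Im z)) has_derivative (\<lambda>h. (Re h, Im h))) (at z0)"
      by (rule has_derivative_Pair[OF bounded_linear_imp_has_derivative[OF bounded_linear_Re]
            bounded_linear_imp_has_derivative[OF bounded_linear_Im]])
    from has_derivative_compose[OF this total]
    have "((\<lambda>z. G (Re z) (Im z)) has_derivative
        (\<lambda>h. Re h *\<^sub>R L (dx x0 y0) + Im h *\<^sub>R L (dy x0 y0))) (at z0)"
      by simp
    moreover have "L (dy x0 y0) = \<i> * L (dx x0 y0)"
      using slice_regularD(3)[OF f I box[OF mem]] by (simp add: dx_def dy_def L_I)
    then have "(\<lambda>h. Re h *\<^sub>R L (dx x0 y0) + Im h *\<^sub>R L (dy x0 y0)) = (*) (L (dx x0 y0))"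
      by (auto simp: fun_eq_iff complex_eq_iff algebra_simps)
    ultimately have "((\<lambda>z. L (f (slice_point I z))) has_field_derivative L (dx x0 y0)) (at z0)"
      by (simp add: has_field_derivative_def G_def slice_point_def)
    then show ?thesis by blast
  qed
  then show ?thesis
    by (intro holomorphic_onI)
      (meson field_differentiable_at_within field_differentiable_def)
qed

text \<open>
  A coordinate of \<open>v\<close> for the complex structure on the quaternions given by left multiplication
  by \<open>J\<close>. Its real part is the component along \<open>a\<close>, so these coordinates separate points.
\<close>
definition slice_component :: "quat \<Rightarrow> quat \<Rightarrow> quat \<Rightarrow> complex" where
  "slice_component J a v = Complex (v \<bullet> a) (v \<bullet> (J * a))"

lemma bounded_linear_slice_component: "bounded_linear (slice_component J a)"
proof -
  have "slice_component J a = (\<lambda>v. of_real (v \<bullet> a) + \<i> * of_real (v \<bullet> (J * a)))"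
    by (simp add: slice_component_def fun_eq_iff complex_eq_iff)
  moreover have "bounded_linear \<dots>"
    by (intro bounded_linear_add bounded_linear_const_mult
        bounded_linear_compose[OF bounded_linear_of_real] bounded_linear_inner_left)
  ultimately show ?thesis by simp
qed

lemma inner_imag_unit_mult:
  assumes "J \<in> imag_units"
  shows "(J * v) \<bullet> a = - (v \<bullet> (J * a))" "(J * v) \<bullet> (J * a) = v \<bullet> a"
proof -
  have skew: "(J * v) \<bullet> a = - (v \<bullet> (J * a))" for v a
    using imag_unit_facts(1)[OF assms] by (simp add: inner_quat_def quat_sel_mult algebra_simps)
  then show "(J * v) \<bullet> a = - (v \<bullet> (J * a))" .
  show "(J * v) \<bullet> (J * a) = v \<bullet> a"
    unfolding skew using imag_unit_facts(3)[OF assms] by (simp flip: mult.assoc)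
qed

lemma slice_component_mult:
  assumes "J \<in> imag_units"
  shows "slice_component J a (J * v) = \<i> * slice_component J a v"
  using inner_imag_unit_mult[OF assms] by (simp add: slice_component_def complex_eq_iff)

text \<open>
  Both sides are regular along the slice of \<open>J\<close> as functions of \<open>z\<close>: on the right because
  \<open>(1 - J I) I = J (1 - J I)\<close> and \<open>(1 + J I) (- I) = J (1 + J I)\<close>. They agree for real \<open>z\<close>, so the
  identity theorem applies to each complex coordinate of their difference.
\<close>
lemma representation_formula:
  assumes f: "slice_regular f \<Omega>" and "open \<Omega>"
    and I: "I \<in> imag_units" and J: "J \<in> imag_units"
    and ball: "ball (of_real x0) r \<subseteq> \<Omega>" and z: "z \<in> ball (of_real x0) r"
  shows "f (slice_point J z) =
    (1/2) *\<^sub>R ((1 - J * I) * f (slice_point I z) + (1 + J * I) * f (slice_point (- I) z))"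
proof -
  define S where "S = ball (complex_of_real x0) r"
  note II = imag_unit_facts(3)[OF I] and JJ = imag_unit_facts(3)[OF J]
  note mI = imag_unit_facts(6)[OF I]
  have S: "S \<subseteq> {z. slice_point K z \<in> \<Omega>}" if K: "K \<in> imag_units" for K
  proof
    fix z assume "z \<in> S"
    then have "dist (slice_point K (of_real x0)) (slice_point K z) < r"
      unfolding dist_slice_point[OF K] by (simp add: S_def)
    then show "z \<in> {z. slice_point K z \<in> \<Omega>}"
      using ball by (auto simp: slice_point_def)
  qed
  have "v \<bullet> a = 0" if v: "v = f (slice_point J z) -
    (1/2) *\<^sub>R ((1 - J * I) * f (slice_point I z) + (1 + J * I) * f (slice_point (- I) z))" for a v
  proof -
    let ?c = "slice_component J a"
    interpret c: bounded_linear ?c by (rule bounded_linear_slice_component)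
    define h where "h z = ?c (f (slice_point J z)) -
      (1/2) * (?c ((1 - J * I) * f (slice_point I z)) + ?c ((1 + J * I) * f (slice_point (- I) z)))" for z
    have intertwine: "?c ((1 - J * I) * (I * v)) = \<i> * ?c ((1 - J * I) * v)"
      "?c ((1 + J * I) * (- I * v)) = \<i> * ?c ((1 + J * I) * v)" for v
    proof -
      have "(1 - J * I) * I = J * (1 - J * I)" "(1 + J * I) * (- I) = J * (1 + J * I)"
        using II JJ by (simp_all add: algebra_simps) (simp_all flip: mult.assoc)
      then show "?c ((1 - J * I) * (I * v)) = \<i> * ?c ((1 - J * I) * v)"
        "?c ((1 + J * I) * (- I * v)) = \<i> * ?c ((1 + J * I) * v)"
        by (simp_all only: mult.assoc[symmetric]) (simp_all only: mult.assoc slice_component_mult[OF J])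
    qed
    have bl: "bounded_linear (\<lambda>v. ?c (q * v))" for q
      by (intro bounded_linear_compose[OF bounded_linear_slice_component] bounded_linear_mult_right)
    have "h holomorphic_on S"
      unfolding h_def[abs_def]
      by (intro holomorphic_intros
          holomorphic_on_subset[OF slice_component_holomorphic[OF f \<open>open \<Omega>\<close> J] S[OF J]]
          holomorphic_on_subset[OF slice_component_holomorphic[OF f \<open>open \<Omega>\<close> I bl] S[OF I]]
          holomorphic_on_subset[OF slice_component_holomorphic[OF f \<open>open \<Omega>\<close> mI bl] S[OF mI]]
          bounded_linear_slice_component slice_component_mult J intertwine)
    moreover have "open S" "connected S" by (simp_all add: S_def)
    moreover have "{z\<in>S. Im z = 0} \<subseteq> S" by blast
    moreover have "r > 0" using z by (auto intro: le_less_trans[OF zero_le_dist])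
    then have "of_real x0 \<in> S" by (simp add: S_def)
    moreover have "of_real x0 islimpt {z\<in>S. Im z = 0}"
      unfolding islimpt_approachable
    proof (intro allI impI)
      fix e :: real assume "e > 0"
      define t where "t = min e r / 2"
      have "t > 0" "t < e" "t < r" using \<open>e > 0\<close> \<open>r > 0\<close> by (auto simp: t_def)
      then show "\<exists>z\<in>{z\<in>S. Im z = 0}. z \<noteq> of_real x0 \<and> dist z (of_real x0) < e"
        by (intro bexI[of _ "of_real (x0 + t)"]) (simp_all add: S_def dist_norm)
    qed
    moreover have "h z = 0" if "z \<in> {z\<in>S. Im z = 0}" for z
    proof -
      have same: "slice_point K z = of_real (Re z)" for K
        using that by (simp add: slice_point_def)
      have "(1 - J * I) * u + (1 + J * I) * u = u + u" for u
        by (simp add: algebra_simps)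
      then show ?thesis
        unfolding h_def same c.add[symmetric] by (simp add: c.add)
    qed
    ultimately have "h z = 0"
      by (rule analytic_continuation) (use z in \<open>simp_all add: S_def\<close>)
    then have "?c v = 0"
      unfolding v c.diff c.scaleR c.add by (simp add: h_def scaleR_conv_of_real)
    then show ?thesis by (simp add: slice_component_def complex_eq_iff)
  qed
  from this[OF refl] show ?thesis
    by (metis eq_iff_diff_eq_0 inner_eq_zero_iff)
qed


text \<open>
  Subtracting the representation formulas at \<open>z\<close> and \<open>cnj z\<close> leaves
  \<open>- (J I) (f (x + y I) - f (x - y I))\<close>, and the factor \<open>J\<close> cancels against
  \<open>inverse (p - qcnj p) = - J / (2 y)\<close>. The limit at a real point therefore involves only the slice
  of \<open>I\<close> and is uniform in \<open>J\<close>.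
\<close>
lemma spherical_quotient_slice_independent:
  assumes f: "slice_regular f \<Omega>" and "open \<Omega>"
    and I: "I \<in> imag_units" and J: "J \<in> imag_units"
    and ball: "ball (of_real x0) r \<subseteq> \<Omega>" and z: "z \<in> ball (of_real x0) r" and "Im z \<noteq> 0"
    and p: "p = slice_point J z"
  shows "inverse (p - qcnj p) * (f p - f (qcnj p)) =
    - I * ((1 / (2 * Im z)) *\<^sub>R (f (slice_point I z) - f (slice_point I (cnj z))))"
proof -
  note JJ = imag_unit_facts(3)[OF J]
  have neg: "slice_point (- K) z = slice_point K (cnj z)"
    "slice_point (- K) (cnj z) = slice_point K z" for K
    by (simp_all add: slice_point_def)
  have cnj_mem: "cnj z \<in> ball (of_real x0) r"
    using z complex_mod_cnj[of "of_real x0 - z"] by (simp add: dist_norm)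
  have qp: "qcnj p = slice_point J (cnj z)"
    using imag_unit_facts(8)[OF J]
    by (simp add: p slice_point_def of_real_def quat_eq_iff)
  let ?F = "f (slice_point I z)" and ?G = "f (slice_point I (cnj z))"
  have rep: "f p = (1/2) *\<^sub>R ((1 - J * I) * ?F + (1 + J * I) * ?G)"
    "f (qcnj p) = (1/2) *\<^sub>R ((1 - J * I) * ?G + (1 + J * I) * ?F)"
    using representation_formula[OF f \<open>open \<Omega>\<close> I J ball z]
      representation_formula[OF f \<open>open \<Omega>\<close> I J ball cnj_mem]
    by (simp_all add: p qp[unfolded p] neg)
  have "2 *\<^sub>R (f p - f (qcnj p)) = 2 *\<^sub>R (- (J * I) * (?F - ?G))"
    unfolding rep by (simp add: scaleR_2 algebra_simps flip: scaleR_add_left)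
  then have diff: "f p - f (qcnj p) = - (J * I) * (?F - ?G)"
    by (simp only: scaleR_cancel_left) simp
  have "p - qcnj p = (2 * Im z) *\<^sub>R J"
    unfolding qp by (simp add: p slice_point_def of_real_def flip: scaleR_add_left)
  then have inv: "inverse (p - qcnj p) = (1 / (2 * Im z)) *\<^sub>R (- J)"
    by (simp only: inverse_scaleR_distrib imag_unit_facts(7)[OF J] inverse_eq_divide[where ?'a = real])
  have "(- J) * (- (J * I) * (?F - ?G)) = - I * (?F - ?G)"
    using JJ by (simp flip: mult.assoc)
  then show ?thesis
    unfolding inv diff by (simp only: mult_scaleR_left mult_scaleR_right)
qed

text \<open>
  The centre \<open>Re z\<close> of the difference quotient moves with \<open>z\<close>, so differentiability at \<open>x0\<close> is not
  enough; the mean value inequality with the continuous derivative is used instead.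
\<close>
lemma symmetric_difference_quotient:
  assumes f: "slice_regular f \<Omega>" and I: "I \<in> imag_units"
    and ball: "ball (of_real x0) r \<subseteq> \<Omega>" and "r > 0" and "\<epsilon> > 0"
  shows "\<exists>\<delta>>0. \<delta> \<le> r \<and> (\<forall>z\<in>ball (of_real x0) \<delta>. Im z \<noteq> 0 \<longrightarrow>
    norm ((1 / (2 * Im z)) *\<^sub>R (f (slice_point I z) - f (slice_point I (cnj z)))
      - slice_dy I f x0 0) < \<epsilon>)"
proof -
  let ?c = "slice_dy I f x0 0"
  have mem: "slice_point I z \<in> \<Omega>" if "z \<in> ball (of_real x0) r" for z
    using that dist_slice_point[OF I, of "of_real x0" z] ball by (auto simp: slice_point_def)
  have "continuous_on {(x, y). of_real x + of_real y * I \<in> \<Omega>} (\<lambda>(x, y). slice_dy I f x y)"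
    using f I by (auto simp: slice_regular_def)
  moreover have "(x0, 0) \<in> {(x, y). of_real x + of_real y * I \<in> \<Omega>}"
    using ball \<open>r > 0\<close> by auto
  ultimately obtain d where d: "d > 0"
    "\<And>x y. of_real x + of_real y * I \<in> \<Omega> \<Longrightarrow> dist (x, y) (x0, 0) < d \<Longrightarrow>
      dist (slice_dy I f x y) ?c < \<epsilon> / 4"
    using \<open>\<epsilon> > 0\<close> unfolding continuous_on_iff
    by (elim ballE[of _ _ "(x0, 0)"] allE[of _ "\<epsilon> / 4"]) (auto split: prod.splits)
  define \<delta> where "\<delta> = min d r"
  have "norm ((1 / (2 * Im z)) *\<^sub>R (f (slice_point I z) - f (slice_point I (cnj z))) - ?c) < \<epsilon>"
    if z: "z \<in> ball (of_real x0) \<delta>" and y: "Im z \<noteq> 0" for z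
  proof -
    define x y where "x = Re z" and "y = Im z"
    define g where "g t = f (of_real x + of_real t * I)" for t
    let ?S = "closed_segment (- y) y"
    have near: "of_real x + of_real t * I \<in> \<Omega>" "dist (slice_dy I f x t) ?c < \<epsilon> / 4"
      if "t \<in> ?S" for t
    proof -
      have "\<bar>t\<bar> \<le> \<bar>y\<bar>" using that by (auto simp: closed_segment_eq_real_ivl split: if_splits)
      then have "(cmod (Complex x t - of_real x0))\<^sup>2 \<le> (cmod (z - of_real x0))\<^sup>2"
        by (simp add: cmod_power2 x_def y_def abs_le_square_iff)
      then have "cmod (Complex x t - of_real x0) \<le> cmod (z - of_real x0)"
        by (rule power2_le_imp_le) simp
      also have "\<dots> < \<delta>" using z by (simp add: dist_norm norm_minus_commute)
      finally have lt: "cmod (Complex x t - of_real x0) < \<delta>" .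
      then have "Complex x t \<in> ball (of_real x0) r"
        by (simp add: \<delta>_def dist_norm norm_minus_commute)
      then show m: "of_real x + of_real t * I \<in> \<Omega>"
        using mem slice_point_Complex by metis
      have "dist (x, t) (x0, 0) = cmod (Complex x t - of_real x0)"
        by (simp add: dist_Pair_Pair dist_real_def cmod_def)
      with lt have "dist (x, t) (x0, 0) < d" by (simp add: \<delta>_def)
      with m show "dist (slice_dy I f x t) ?c < \<epsilon> / 4" by (intro d)
    qed
    have 0: "0 \<in> ?S" by (auto simp: closed_segment_eq_real_ivl)
    have "norm (g y - g (- y) - (y - - y) *\<^sub>R slice_dy I f x 0) \<le> norm (y - - y) * (\<epsilon> / 2)"
    proof (rule vector_differentiable_bound_linearization[where S = ?S])
      fix t assume t: "t \<in> ?S"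
      show "(g has_vector_derivative slice_dy I f x t) (at t within ?S)"
        unfolding g_def[abs_def]
        by (rule has_vector_derivative_at_within[OF slice_regularD(2)[OF f I near(1)[OF t]]])
      have "dist (slice_dy I f x t) (slice_dy I f x 0) < \<epsilon> / 2"
        by (rule dist_triangle_half_l[where y = ?c]) (use near(2)[OF t] near(2)[OF 0] in simp_all)
      then show "norm (slice_dy I f x t - slice_dy I f x 0) \<le> \<epsilon> / 2" by (simp add: dist_norm)
    qed (rule order.refl, rule 0)
    then have "\<bar>1 / (2 * y)\<bar> * norm (g y - g (- y) - (2 * y) *\<^sub>R slice_dy I f x 0) \<le>
        \<bar>1 / (2 * y)\<bar> * (\<bar>2 * y\<bar> * (\<epsilon> / 2))"
      by (intro mult_left_mono) simp_all
    also have "\<dots> = \<epsilon> / 2" using y by (simp add: y_def)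
    finally have "norm ((1 / (2 * y)) *\<^sub>R (g y - g (- y)) - slice_dy I f x 0) \<le> \<epsilon> / 2"
      unfolding norm_scaleR[symmetric] using y by (simp add: scaleR_diff_right y_def)
    moreover have "norm (slice_dy I f x 0 - ?c) < \<epsilon> / 4"
      using near(2)[OF 0] by (simp add: dist_norm)
    ultimately have "norm ((1 / (2 * y)) *\<^sub>R (g y - g (- y)) - ?c) < \<epsilon>"
      using norm_triangle_ineq[of "(1 / (2 * y)) *\<^sub>R (g y - g (- y)) - slice_dy I f x 0"
          "slice_dy I f x 0 - ?c"] \<open>\<epsilon> > 0\<close> by simp
    then show ?thesis by (simp add: g_def slice_point_def x_def y_def)
  qed
  then show ?thesis using d \<open>r > 0\<close> by (intro exI[of _ \<delta>]) (auto simp: \<delta>_def)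
qed

text \<open>
  Since \<open>slice_dy = I * slice_dx\<close>, the limit \<open>- I * slice_dy\<close> of the spherical quotients is
  \<open>slice_dx\<close>.
\<close>
lemma spherical_deriv_eq_slice_deriv_on_reals:
  assumes f: "slice_regular f \<Omega>" and "open \<Omega>" and "w \<in> \<Omega>" and "w \<in> \<real>"
  shows "spherical_deriv f w = slice_deriv f w"
proof -
  define I where "I = slice_unit w"
  have I: "I \<in> imag_units" by (simp add: I_def slice_unit)
  obtain x0 where w: "w = of_real x0" using \<open>w \<in> \<real>\<close> by (auto elim: Reals_cases)
  have sd: "slice_deriv f w = - I * slice_dy I f x0 0"
  proof -
    have "qre w = x0" "w \<bullet> I = 0"
      using imag_unit_facts(1)[OF I] by (simp_all add: w inner_quat_def)
    then have "slice_deriv f w = slice_dx I f x0 0"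
      using slice_deriv_eq_dx[OF f \<open>w \<in> \<Omega>\<close>] by (simp add: I_def)
    moreover have "slice_dy I f x0 0 = I * slice_dx I f x0 0"
      using \<open>w \<in> \<Omega>\<close> by (intro slice_regularD(3)[OF f I]) (simp add: w)
    ultimately show ?thesis
      using imag_unit_facts(3)[OF I] by (simp flip: mult.assoc)
  qed
  obtain r where r: "r > 0" "ball w r \<subseteq> \<Omega>"
    using \<open>open \<Omega>\<close> \<open>w \<in> \<Omega>\<close> open_contains_ball by blast
  have "((\<lambda>p. inverse (p - qcnj p) * (f p - f (qcnj p))) \<longlongrightarrow> slice_deriv f w) (at w within - \<real>)"
    unfolding Lim_within
  proof (intro allI impI)
    fix \<epsilon> :: real assume "\<epsilon> > 0"
    from symmetric_difference_quotient[OF f I r(2)[unfolded w] r(1) this]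
    obtain \<delta> where \<delta>: "\<delta> > 0" "\<delta> \<le> r" "\<And>z. z \<in> ball (of_real x0) \<delta> \<Longrightarrow> Im z \<noteq> 0 \<Longrightarrow>
      norm ((1 / (2 * Im z)) *\<^sub>R (f (slice_point I z) - f (slice_point I (cnj z)))
        - slice_dy I f x0 0) < \<epsilon>" by blast
    have "dist (inverse (p - qcnj p) * (f p - f (qcnj p))) (slice_deriv f w) < \<epsilon>"
      if p: "p \<notin> \<real>" "dist p w < \<delta>" for p
    proof -
      obtain J z where J: "J \<in> imag_units" and pz: "p = slice_point J z"
        using quat_eq_slice_point by blast
      have "Im z \<noteq> 0" using p by (auto simp: pz slice_point_def)
      have "dist (slice_point J z) (slice_point J (of_real x0)) < \<delta>"
        using p by (simp add: pz w slice_point_def)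
      then have z: "z \<in> ball (of_real x0) \<delta>"
        by (simp add: dist_slice_point[OF J] dist_commute)
      then have zr: "z \<in> ball (of_real x0) r" using \<delta> by auto
      let ?q = "(1 / (2 * Im z)) *\<^sub>R (f (slice_point I z) - f (slice_point I (cnj z)))"
      have "inverse (p - qcnj p) * (f p - f (qcnj p)) - slice_deriv f w =
          - I * (?q - slice_dy I f x0 0)"
        unfolding sd spherical_quotient_slice_independent[OF f \<open>open \<Omega>\<close> I J
            r(2)[unfolded w] zr \<open>Im z \<noteq> 0\<close> pz]
        by (simp only: right_diff_distrib)
      also have "norm \<dots> = norm (?q - slice_dy I f x0 0)"
        using imag_unit_facts(4)[OF I] by (simp add: norm_mult)
      also have "\<dots> < \<epsilon>" using z \<open>Im z \<noteq> 0\<close> by (rule \<delta>)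
      finally show ?thesis by (simp add: dist_norm)
    qed
    then show "\<exists>d>0. \<forall>p\<in>- \<real>. 0 < dist p w \<and> dist p w < d \<longrightarrow>
        dist (inverse (p - qcnj p) * (f p - f (qcnj p))) (slice_deriv f w) < \<epsilon>"
      using \<delta>(1) by auto
  qed
  moreover have "w islimpt - \<real>"
    unfolding islimpt_approachable
  proof (intro allI impI)
    fix e :: real assume "e > 0"
    let ?p = "w + (e / 2) *\<^sub>R I"
    have "?p \<notin> \<real>"
    proof
      assume "?p \<in> \<real>"
      then obtain t where "?p = of_real t" by (auto elim: Reals_cases)
      then have "?p \<bullet> I = of_real t \<bullet> I" by simp
      then show False
        using imag_unit_facts(1,2)[OF I] \<open>e > 0\<close>
        by (simp add: w inner_add_left) (simp add: inner_quat_def)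
    qed
    then show "\<exists>p\<in>- \<real>. p \<noteq> w \<and> dist p w < e"
      using imag_unit_facts(4,5)[OF I] \<open>e > 0\<close> by (intro bexI[of _ ?p]) (auto simp: dist_norm)
  qed
  ultimately show ?thesis
    using \<open>w \<in> \<real>\<close> by (simp add: spherical_deriv_def tendsto_Lim trivial_limit_within)
qed


section \<open>Slices as subfields and their orthogonal complements\<close>

lemma mem_slice_iff:
  assumes "I \<in> imag_units"
  shows "v \<in> slice I \<longleftrightarrow> v = (v \<bullet> 1) *\<^sub>R 1 + (v \<bullet> I) *\<^sub>R I"
proof
  assume "v \<in> slice I"
  from slice_coords[OF assms this] show "v = (v \<bullet> 1) *\<^sub>R 1 + (v \<bullet> I) *\<^sub>R I"
    by (simp add: of_real_def inner_quat_def)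
next
  assume "v = (v \<bullet> 1) *\<^sub>R 1 + (v \<bullet> I) *\<^sub>R I"
  then show "v \<in> slice I"
    unfolding slice_def of_real_def
    by (intro CollectI exI[of _ "v \<bullet> 1"] exI[of _ "v \<bullet> I"]) simp
qed

lemma closed_slice:
  assumes "I \<in> imag_units"
  shows "closed (slice I)"
proof -
  have "slice I = {v. v = (v \<bullet> 1) *\<^sub>R 1 + (v \<bullet> I) *\<^sub>R I}"
    using mem_slice_iff[OF assms] by blast
  also have "closed \<dots>" by (intro closed_Collect_eq continuous_intros)
  finally show ?thesis .
qed

lemma slice_memI: "of_real x + of_real y * I \<in> slice I"
  by (auto simp: slice_def)

lemma of_real_mem_slice: "of_real x \<in> slice I"
  using slice_memI[of x 0 I] by simp

lemma slice_scaleR: "a \<in> slice I \<Longrightarrow> c *\<^sub>R a \<in> slice I"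
proof -
  assume "a \<in> slice I"
  then obtain x y where "a = of_real x + of_real y * I" by (auto simp: slice_def)
  then have "c *\<^sub>R a = of_real (c * x) + of_real (c * y) * I"
    by (simp add: of_real_def scaleR_add_right)
  then show ?thesis by (simp only: slice_memI)
qed

lemma slice_add: "a \<in> slice I \<Longrightarrow> b \<in> slice I \<Longrightarrow> a + b \<in> slice I"
proof -
  assume "a \<in> slice I" "b \<in> slice I"
  then obtain x y s t where "a = of_real x + of_real y * I" "b = of_real s + of_real t * I"
    by (auto simp: slice_def)
  then have "a + b = of_real (x + s) + of_real (y + t) * I" by (simp add: algebra_simps)
  then show ?thesis by (simp only: slice_memI)
qed

lemma slice_diff: "a \<in> slice I \<Longrightarrow> b \<in> slice I \<Longrightarrow> a - b \<in> slice I"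
  using slice_add[of a I "(-1) *\<^sub>R b"] slice_scaleR[of b I "-1"] by simp

lemma slice_mult:
  assumes "I \<in> imag_units" "a \<in> slice I" "b \<in> slice I"
  shows "a * b \<in> slice I"
proof -
  obtain x y s t where ab: "a = x *\<^sub>R 1 + y *\<^sub>R I" "b = s *\<^sub>R 1 + t *\<^sub>R I"
    using assms mem_slice_iff[OF assms(1)] by metis
  have "a * b = (x * s) *\<^sub>R 1 + ((x * t) *\<^sub>R I + (y * s) *\<^sub>R I) - (y * t) *\<^sub>R 1"
    using imag_unit_facts(3)[OF assms(1)] by (simp add: ab algebra_simps)
  also have "\<dots> = of_real (x * s - y * t) + of_real (x * t + y * s) * I"
    by (simp add: of_real_def algebra_simps)
  finally show ?thesis by (simp only: slice_memI)
qed

lemma qcnj_slice_coords: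
  assumes "I \<in> imag_units"
  shows "qcnj (of_real x + of_real y * I) = of_real x + of_real y * (- I)"
  using imag_unit_facts(1)[OF assms] by (simp add: quat_eq_iff of_real_def)

lemma slice_qcnj:
  assumes "I \<in> imag_units" "a \<in> slice I"
  shows "qcnj a \<in> slice I"
proof -
  obtain x y where a: "a = of_real x + of_real y * I" using assms(2) by (auto simp: slice_def)
  then have "qcnj a = of_real x + of_real (- y) * I"
    by (simp add: qcnj_slice_coords[OF assms(1)])
  then show ?thesis by (simp only: slice_memI)
qed

lemma slice_inverse:
  assumes "I \<in> imag_units" "a \<in> slice I"
  shows "inverse a \<in> slice I"
  unfolding inverse_quat_def by (intro slice_scaleR slice_qcnj assms)

lemma slice_eq_if_common_nonreal_point:
  assumes "I \<in> imag_units" "J \<in> imag_units" "w \<in> slice I" "w \<in> slice J" "w \<notin> \<real>"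
  shows "slice I = slice J"
proof -
  have sub: "slice I \<subseteq> slice J"
    if I: "I \<in> imag_units" and J: "J \<in> imag_units" and w: "w \<in> slice I" "w \<in> slice J" for I J
  proof -
    obtain x y where xy: "w = of_real x + of_real y * I" using w by (auto simp: slice_def)
    with \<open>w \<notin> \<real>\<close> have "y \<noteq> 0" by auto
    then have "I = (1 / y) *\<^sub>R (w - of_real x)" by (simp add: xy of_real_def)
    also have "\<dots> \<in> slice J" by (intro slice_scaleR slice_diff w of_real_mem_slice)
    finally have "of_real s + of_real t * I \<in> slice J" for s t
      by (intro slice_add of_real_mem_slice slice_mult J)
    then show ?thesis by (auto simp: slice_def[of I])
  qed
  from sub[of I J] sub[of J I] show ?thesis using assms by blast
qed

lemma qcnj_mult: "qcnj (p * q) = qcnj q * qcnj p"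
  by (simp add: quat_eq_iff quat_sel_mult)

lemma qcnj_arith [simp]:
  "qcnj (p + q) = qcnj p + qcnj q" "qcnj (p - q) = qcnj p - qcnj q" "qcnj (c *\<^sub>R p) = c *\<^sub>R qcnj p"
  "qcnj (qcnj p) = p" "qcnj 1 = 1"
  by (simp_all add: quat_eq_iff)

lemma norm_qcnj [simp]: "norm (qcnj p) = norm p"
  by (simp add: norm_quat_def)

lemma inner_mult_left_quat: "(p * a) \<bullet> b = p \<bullet> (b * qcnj a)"
  by (simp add: inner_quat_def quat_sel_mult algebra_simps)

lemma slice_inner_orthogonal_comp:
  "a \<in> slice I \<Longrightarrow> b \<in> orthogonal_comp (slice I) \<Longrightarrow> b \<bullet> a = 0"
  by (auto simp: orthogonal_comp_def orthogonal_def inner_commute)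

text \<open>
  Right multiplication by \<open>a\<close> has adjoint right multiplication by \<open>qcnj a\<close>, and the latter maps the
  slice into itself.
\<close>
lemma orthogonal_comp_slice_mult:
  assumes "I \<in> imag_units" "a \<in> slice I" "b \<in> orthogonal_comp (slice I)"
  shows "b * a \<in> orthogonal_comp (slice I)"
proof -
  have "(b * a) \<bullet> c = 0" if "c \<in> slice I" for c
    unfolding inner_mult_left_quat
    by (intro slice_inner_orthogonal_comp[OF _ assms(3)] slice_mult slice_qcnj that assms)
  then show ?thesis by (auto simp: orthogonal_comp_def orthogonal_def inner_commute)
qed

lemma norm_add_orthogonal_slice:
  assumes "a \<in> slice I" "b \<in> orthogonal_comp (slice I)"
  shows "(norm (a + b))\<^sup>2 = (norm a)\<^sup>2 + (norm b)\<^sup>2"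
  using slice_inner_orthogonal_comp[OF assms]
  by (simp add: norm_quat_square inner_add_left inner_add_right inner_commute[of a b])

lemma quat_eqI_qre_mult:
  assumes "\<And>a. qre (p * a) = qre (q * a)"
  shows "p = q"
proof -
  have "qre ((p - q) * qcnj (p - q)) = 0"
    using assms[of "qcnj (p - q)"] by (simp add: left_diff_distrib)
  then show ?thesis by (simp only: mult_qcnj quat_sel_of_real) simp
qed

text \<open>
  Real translations of \<open>w\<close> stay in the slice, so the difference quotients take values in the
  slice, which is closed.
\<close>
lemma slice_deriv_mem_slice:
  assumes f: "slice_regular f \<Omega>" and "open \<Omega>" and w: "w \<in> \<Omega>" "w \<in> slice I"
    and I: "I \<in> imag_units" and pres: "f ` (\<Omega> \<inter> slice I) \<subseteq> slice I"
  shows "slice_deriv f w \<in> slice I"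
proof (rule Lim_in_closed_set[OF closed_slice[OF I] _ _ slice_deriv_is_real_direction_derivative[OF f w(1)]])
  obtain r where r: "r > 0" "ball w r \<subseteq> \<Omega>"
    using \<open>open \<Omega>\<close> w(1) open_contains_ball by blast
  have "(1/t) *\<^sub>R (f (w + of_real t) - f w) \<in> slice I" if "dist t 0 < r" for t
  proof -
    have "w + of_real t \<in> \<Omega>"
      using r that by (intro subsetD[OF r(2)]) (simp add: dist_norm)
    moreover have "w + of_real t \<in> slice I" by (intro slice_add w of_real_mem_slice)
    ultimately have "f (w + of_real t) \<in> slice I" "f w \<in> slice I"
      using pres w by blast+
    then show ?thesis by (intro slice_scaleR slice_diff)
  qed
  then show "\<forall>\<^sub>F t in at 0. (1/t) *\<^sub>R (f (w + of_real t) - f w) \<in> slice I"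
    using r(1) by (auto simp: eventually_at)
qed simp

section \<open>Representing the derivatives in a reproducing kernel Hilbert space\<close>

context quat_rkhs
begin

lemma ip_scale_left:
  assumes "f \<in> H" "g \<in> H"
  shows "ip (\<lambda>q\<in>\<Omega>. f q * a) g = ip f g * a"
proof -
  have "(\<lambda>q\<in>\<Omega>. g q * 1) = g"
    using assms extensional_mem by (auto intro: extensionalityI)
  with ip_scale[OF assms, of a 1] show ?thesis by simp
qed

lemma ip_scale_right:
  assumes "f \<in> H" "g \<in> H"
  shows "ip f (\<lambda>q\<in>\<Omega>. g q * b) = qcnj b * ip f g"
  using ip_cnj[OF scale_mem[OF assms(2)] assms(1), of b] ip_scale_left[OF assms(2,1), of b]
    ip_cnj[OF assms(2,1)] by (simp add: qcnj_mult)

lemma ip_add_right: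
  assumes "f \<in> H" "g \<in> H" "h \<in> H"
  shows "ip h (\<lambda>q\<in>\<Omega>. f q + g q) = ip h f + ip h g"
  using ip_cnj[OF add_mem[OF assms(1,2)] assms(3)] ip_add[OF assms]
    ip_cnj[OF assms(1,3)] ip_cnj[OF assms(2,3)] by simp

lemma combination_eq:
  "(\<lambda>q\<in>\<Omega>. f q * a + g q * b) = (\<lambda>q\<in>\<Omega>. (\<lambda>q\<in>\<Omega>. f q * a) q + (\<lambda>q\<in>\<Omega>. g q * b) q)"
  by (simp add: fun_eq_iff)

lemma combination_mem:
  "\<lbrakk>f \<in> H; g \<in> H\<rbrakk> \<Longrightarrow> (\<lambda>q\<in>\<Omega>. f q * a + g q * b) \<in> H"
  unfolding combination_eq by (intro add_mem scale_mem)

lemma ip_combination_left: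
  "\<lbrakk>f \<in> H; g \<in> H; h \<in> H\<rbrakk> \<Longrightarrow> ip (\<lambda>q\<in>\<Omega>. f q * a + g q * b) h = ip f h * a + ip g h * b"
  unfolding combination_eq by (simp only: ip_add scale_mem ip_scale_left)

lemma ip_combination_right:
  "\<lbrakk>f \<in> H; g \<in> H; h \<in> H\<rbrakk> \<Longrightarrow>
    ip h (\<lambda>q\<in>\<Omega>. f q * a + g q * b) = qcnj a * ip h f + qcnj b * ip h g"
  unfolding combination_eq by (simp only: ip_add_right scale_mem ip_scale_right)

lemma ip_self_real: "f \<in> H \<Longrightarrow> ip f f = of_real ((hnorm ip f)\<^sup>2)"
  using ip_cnj[of f f] ip_nonneg[of f] by (simp add: hnorm_def quat_eq_iff)

lemma hnorm_combination:
  assumes "f \<in> H" "g \<in> H"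
  shows "(hnorm ip (\<lambda>q\<in>\<Omega>. f q * qcnj a + g q * qcnj b))\<^sup>2 =
    (hnorm ip f)\<^sup>2 * (norm a)\<^sup>2 + (hnorm ip g)\<^sup>2 * (norm b)\<^sup>2 + 2 * qre (b * ip f g * qcnj a)"
proof -
  let ?u = "\<lambda>q\<in>\<Omega>. f q * qcnj a + g q * qcnj b"
  have u: "?u \<in> H" using assms by (rule combination_mem)
  have "ip ?u ?u = a * (ip f f * qcnj a + ip g f * qcnj b) + b * (ip f g * qcnj a + ip g g * qcnj b)"
    using assms u by (simp add: ip_combination_right ip_combination_left)
  moreover have "qre (a * of_real c * qcnj a) = c * (norm a)\<^sup>2" for a c
    by (simp add: norm_quat_square inner_quat_def quat_sel_mult algebra_simps)
  moreover have "qre (a * ip g f * qcnj b) = qre (b * ip f g * qcnj a)"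
    unfolding ip_cnj[OF assms] by (simp add: quat_sel_mult algebra_simps)
  ultimately have "qre (ip ?u ?u) =
      (hnorm ip f)\<^sup>2 * (norm a)\<^sup>2 + (hnorm ip g)\<^sup>2 * (norm b)\<^sup>2 + 2 * qre (b * ip f g * qcnj a)"
    by (simp add: distrib_left ip_self_real[OF assms(1)] ip_self_real[OF assms(2)]
        del: of_real_power flip: mult.assoc)
  then show ?thesis using ip_nonneg[OF u] by (simp add: hnorm_def)
qed

lemma kernel_hermitian:
  "\<lbrakk>p \<in> \<Omega>; q \<in> \<Omega>\<rbrakk> \<Longrightarrow> qcnj (k p q) = k q p"
  using ip_cnj[OF kernel_mem kernel_mem, of p q] reproducing[OF _ kernel_mem] by simp

lemma real_combination_eq:
  "(\<lambda>q\<in>\<Omega>. a *\<^sub>R f q + b *\<^sub>R g q) = (\<lambda>q\<in>\<Omega>. f q * of_real a + g q * of_real b)"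
  by (simp add: of_real_def)

lemma qcnj_of_real: "qcnj (of_real c) = of_real c"
  by (simp add: quat_eq_iff)

lemma real_hilbert_carrier:
  "real_hilbert_carrier H (\<lambda>a f b g. \<lambda>q\<in>\<Omega>. a *\<^sub>R f q + b *\<^sub>R g q) (\<lambda>f g. qre (ip f g))"
proof
  show "H \<noteq> {}" using zero_mem by blast
  fix f g h a b
  show "(\<lambda>q\<in>\<Omega>. a *\<^sub>R f q + b *\<^sub>R g q) \<in> H" if "f \<in> H" "g \<in> H"
    unfolding real_combination_eq using that by (rule combination_mem)
  show "qre (ip (\<lambda>q\<in>\<Omega>. a *\<^sub>R f q + b *\<^sub>R g q) h) = a * qre (ip f h) + b * qre (ip g h)"
    if "f \<in> H" "g \<in> H" "h \<in> H"
    unfolding real_combination_eq ip_combination_left[OF that] by (simp add: quat_sel_mult)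
  show "qre (ip f g) = qre (ip g f)" if "f \<in> H" "g \<in> H"
    using ip_cnj[OF that] by simp
  show "0 \<le> qre (ip f f)" if "f \<in> H" using that by (rule ip_nonneg)
  show "f = g" if fg: "f \<in> H" "g \<in> H" and
    0: "qre (ip (\<lambda>q\<in>\<Omega>. 1 *\<^sub>R f q + (-1) *\<^sub>R g q) (\<lambda>q\<in>\<Omega>. 1 *\<^sub>R f q + (-1) *\<^sub>R g q)) = 0"
  proof -
    let ?d = "\<lambda>q\<in>\<Omega>. 1 *\<^sub>R f q + (-1) *\<^sub>R g q"
    have d: "?d \<in> H" unfolding real_combination_eq using fg by (rule combination_mem)
    then have "ip ?d ?d = 0" using 0 ip_self_real[OF d] by (simp add: hnorm_def)
    from ip_definite[OF d this] have "f q = g q" if "q \<in> \<Omega>" for q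
      using that by (auto simp: fun_eq_iff split: if_splits)
    then show ?thesis using fg extensional_mem by (auto intro: extensionalityI)
  qed
next
  fix F
  assume F: "\<And>n. F n \<in> H"
    and C: "\<And>e. e > 0 \<Longrightarrow> \<exists>N::nat. \<forall>m\<ge>N. \<forall>n\<ge>N.
      sqrt (qre (ip (\<lambda>q\<in>\<Omega>. 1 *\<^sub>R F m q + (-1) *\<^sub>R F n q) (\<lambda>q\<in>\<Omega>. 1 *\<^sub>R F m q + (-1) *\<^sub>R F n q))) < e"
  show "\<exists>f\<in>H. (\<lambda>n. sqrt (qre (ip (\<lambda>q\<in>\<Omega>. 1 *\<^sub>R F n q + (-1) *\<^sub>R f q)
      (\<lambda>q\<in>\<Omega>. 1 *\<^sub>R F n q + (-1) *\<^sub>R f q)))) \<longlonglongrightarrow> 0"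
    using complete[OF F] C by (simp add: hnorm_def)
qed

sublocale real: real_hilbert_carrier H "\<lambda>a f b g. \<lambda>q\<in>\<Omega>. a *\<^sub>R f q + b *\<^sub>R g q" "\<lambda>f g. qre (ip f g)"
  by (rule real_hilbert_carrier)

text \<open>
  The difference quotients \<open>D n\<close> of the kernel in its first argument converge weakly, as their inner
  products with any \<open>f\<close> are difference quotients of \<open>f\<close>. Testing the weak limit against the
  right multiples of \<open>k q\<close> identifies its values.
\<close>
lemma slice_deriv_representer_mem:
  assumes "open \<Omega>" and regular: "\<And>f. f \<in> H \<Longrightarrow> slice_regular f \<Omega>" and w: "w \<in> \<Omega>"
  shows "(\<lambda>q\<in>\<Omega>. qcnj (slice_deriv (k q) w)) \<in> H"
proof -
  obtain r where r: "r > 0" "ball w r \<subseteq> \<Omega>"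
    using \<open>open \<Omega>\<close> w open_contains_ball by blast
  define t where "t n = r / 2 * inverse (real (Suc n))" for n
  have t_pos: "t n > 0" for n using r by (simp add: t_def)
  have wt: "w + of_real (t n) \<in> \<Omega>" for n
  proof -
    have "inverse (real (Suc n)) \<le> 1" by (simp add: inverse_le_1_iff)
    then have "t n \<le> r / 2 * 1" unfolding t_def using r by (intro mult_left_mono) auto
    then have "t n < r" using r by simp
    then show ?thesis using t_pos[of n] by (intro subsetD[OF r(2)]) (simp add: dist_norm)
  qed
  have "t \<longlonglongrightarrow> 0"
    unfolding t_def[abs_def] by (rule tendsto_mult_right_zero[OF LIMSEQ_inverse_real_of_nat])
  then have t: "filterlim t (at 0) sequentially"
    using t_pos by (auto simp: filterlim_at less_imp_neq[symmetric])
  define D where "D n = (\<lambda>q\<in>\<Omega>. (1 / t n) *\<^sub>R k (w + of_real (t n)) q + (- (1 / t n)) *\<^sub>R k w q)" for n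
  have DH: "D n \<in> H" for n
    unfolding D_def by (intro real.lin_mem kernel_mem wt w)
  have ip_D: "ip f (D n) = (1 / t n) *\<^sub>R (f (w + of_real (t n)) - f w)" if "f \<in> H" for f n
    unfolding D_def real_combination_eq
      ip_combination_right[OF kernel_mem[OF wt] kernel_mem[OF w] that]
      reproducing[OF w that, symmetric] reproducing[OF wt that, symmetric] qcnj_of_real
    by (simp only: of_real_def scaleR_minus_left mult_minus_left mult_scaleR_left mult_1_left
        diff_conv_add_uminus scaleR_add_right scaleR_minus_right)
  have lim: "(\<lambda>n. ip f (D n)) \<longlonglongrightarrow> slice_deriv f w" if "f \<in> H" for f
    unfolding ip_D[OF that]
    using filterlim_compose[OF slice_deriv_is_real_direction_derivative[OF regular[OF that] w] t] .
  have qre_tendsto: "(\<lambda>n. qre (F n)) \<longlonglongrightarrow> qre l" if "F \<longlonglongrightarrow> l" for F l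
    using tendsto_inner[OF that tendsto_const, of 1] by (simp add: inner_quat_def)
  obtain x where x: "x \<in> H" "\<And>f. f \<in> H \<Longrightarrow> qre (ip f x) = qre (slice_deriv f w)"
    using real.weakly_sequentially_complete[OF DH qre_tendsto[OF lim]] by blast
  have "x q = qcnj (slice_deriv (k q) w)" if q: "q \<in> \<Omega>" for q
  proof -
    have kq: "k q \<in> H" using q by (rule kernel_mem)
    have "ip (k q) x = slice_deriv (k q) w"
    proof (rule quat_eqI_qre_mult)
      fix a
      let ?ka = "\<lambda>p\<in>\<Omega>. k q p * a"
      have ka: "?ka \<in> H" using kq by (rule scale_mem)
      have "(\<lambda>n. ip (k q) (D n) * a) \<longlonglongrightarrow> slice_deriv (k q) w * a"
        by (intro tendsto_mult lim kq tendsto_const)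
      then have "(\<lambda>n. ip ?ka (D n)) \<longlonglongrightarrow> slice_deriv (k q) w * a"
        by (simp add: ip_scale_left[OF kq DH])
      from LIMSEQ_unique[OF this lim[OF ka]] show "qre (ip (k q) x * a) = qre (slice_deriv (k q) w * a)"
        using x(2)[OF ka] by (simp add: ip_scale_left[OF kq x(1)])
    qed
    then show ?thesis
      using reproducing[OF q x(1)] ip_cnj[OF kq x(1)] by simp
  qed
  then have "(\<lambda>q\<in>\<Omega>. qcnj (slice_deriv (k q) w)) = x"
    by (intro extensionalityI[of _ \<Omega>]) (use x(1) extensional_mem in auto)
  then show ?thesis using x(1) by simp
qed

text \<open>
  At a non-real point the spherical derivative is a combination of two point evaluations.
\<close>
lemma spherical_deriv_representer:
  assumes w: "w \<in> \<Omega>" "qcnj w \<in> \<Omega>" "w \<notin> \<real>"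
  shows "(\<lambda>q\<in>\<Omega>. qcnj (spherical_deriv (k q) w)) \<in> H"
    and "f \<in> H \<Longrightarrow> ip f (\<lambda>q\<in>\<Omega>. qcnj (spherical_deriv (k q) w)) = spherical_deriv f w"
proof -
  define c where "c = inverse (w - qcnj w)"
  have *: "(\<lambda>q\<in>\<Omega>. qcnj (spherical_deriv (k q) w)) = (\<lambda>q\<in>\<Omega>. k w q * qcnj c + k (qcnj w) q * (- qcnj c))"
  proof (rule restrict_ext)
    fix q assume "q \<in> \<Omega>"
    then show "qcnj (spherical_deriv (k q) w) = k w q * qcnj c + k (qcnj w) q * (- qcnj c)"
      using w by (simp add: spherical_deriv_def c_def qcnj_mult kernel_hermitian left_diff_distrib)
  qed
  show "(\<lambda>q\<in>\<Omega>. qcnj (spherical_deriv (k q) w)) \<in> H"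
    unfolding * using w by (intro combination_mem kernel_mem)
  have "qcnj (- qcnj c) = - c" by (simp add: quat_eq_iff)
  then show "ip f (\<lambda>q\<in>\<Omega>. qcnj (spherical_deriv (k q) w)) = spherical_deriv f w" if "f \<in> H"
    unfolding * ip_combination_right[OF kernel_mem[OF w(1)] kernel_mem[OF w(2)] that]
      reproducing[OF w(1) that, symmetric] reproducing[OF w(2) that, symmetric]
    using w(3) by (simp add: spherical_deriv_def c_def right_diff_distrib)
qed

lemma rkhs_metric_sq_eq:
  assumes C: "(\<lambda>q\<in>\<Omega>. qcnj (slice_deriv (k q) w)) \<in> H" (is "?C \<in> H")
    and S: "(\<lambda>q\<in>\<Omega>. qcnj (spherical_deriv (k q) w)) \<in> H" (is "?S \<in> H")
    and w: "w \<in> \<Omega>"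
    and d1: "slice_proj (slice_unit w) d = d1" and d2: "d = d1 + d2"
  shows "rkhs_metric_sq \<Omega> ip k w d =
    ((hnorm ip (k w))\<^sup>2 * ((hnorm ip ?C)\<^sup>2 * (norm d1)\<^sup>2 + (hnorm ip ?S)\<^sup>2 * (norm d2)\<^sup>2 +
        2 * qre (d2 * ip ?C ?S * qcnj d1)) -
      (norm (d1 * slice_deriv (k w) w + d2 * spherical_deriv (k w) w))\<^sup>2) / (hnorm ip (k w)) ^ 4"
proof -
  let ?u = "\<lambda>q\<in>\<Omega>. qcnj (d1 * slice_deriv (k q) w + d2 * spherical_deriv (k q) w)"
  have u: "?u = (\<lambda>q\<in>\<Omega>. ?C q * qcnj d1 + ?S q * qcnj d2)"
    by (auto simp: fun_eq_iff qcnj_mult)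
  have uH: "?u \<in> H" unfolding u using C S by (rule combination_mem)
  have "ip (k w) ?u = qcnj (?u w)"
    using ip_cnj[OF uH kernel_mem[OF w]] reproducing[OF w uH] by simp
  then have "ip (k w) ?u = d1 * slice_deriv (k w) w + d2 * spherical_deriv (k w) w"
    using w by simp
  moreover have "(hnorm ip ?u)\<^sup>2 = (hnorm ip ?C)\<^sup>2 * (norm d1)\<^sup>2 + (hnorm ip ?S)\<^sup>2 * (norm d2)\<^sup>2 +
      2 * qre (d2 * ip ?C ?S * qcnj d1)"
    unfolding u by (rule hnorm_combination[OF C S])
  moreover have "d - d1 = d2" using d2 by simp
  ultimately show ?thesis
    by (simp only: rkhs_metric_sq_def d1 Let_def)
qed

end

section \<open>Length of tangent vectors for a slice preserving kernel\<close>

lemma symmetric_domain_qcnj: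
  assumes "symmetric_domain \<Omega>" "w \<in> \<Omega>"
  shows "qcnj w \<in> \<Omega>"
proof -
  obtain I z where I: "I \<in> imag_units" and w: "w = of_real (Re z) + of_real (Im z) * I"
    using quat_eq_slice_point[of w] by (auto simp: slice_point_def)
  have "of_real (Re z) + of_real (Im z) * (- I) \<in> \<Omega>"
    using assms I imag_unit_facts(6)[OF I] unfolding symmetric_domain_def w by blast
  then show ?thesis unfolding w qcnj_slice_coords[OF I] .
qed


theorem theorem3p2:
  fixes \<Omega> :: "quat set"
    and H :: "(quat \<Rightarrow> quat) set"
    and ip :: "(quat \<Rightarrow> quat) \<Rightarrow> (quat \<Rightarrow> quat) \<Rightarrow> quat"
    and k :: "quat \<Rightarrow> quat \<Rightarrow> quat"
    and w d1 d2 I :: quat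
  assumes "slice_domain \<Omega>" and "symmetric_domain \<Omega>"
    and "quat_rkhs \<Omega> H ip k"
    and "\<forall>f\<in>H. slice_regular f \<Omega>"
    and "slice_preserving_kernel \<Omega> k"
    and "w \<in> \<Omega>" and "I \<in> imag_units" and "w \<in> slice I"
    and "d1 \<in> slice I" and "d2 \<in> orthogonal_comp (slice I)"
  shows "rkhs_metric_sq \<Omega> ip k w (d1 + d2) =
      ((hnorm ip (k w))\<^sup>2 * (hnorm ip (\<lambda>q\<in>\<Omega>. qcnj (slice_deriv (k q) w)))\<^sup>2
        - (norm (qcnj (slice_deriv (k w) w)))\<^sup>2) / (hnorm ip (k w)) ^ 4 * (norm d1)\<^sup>2
    + ((hnorm ip (k w))\<^sup>2 * (hnorm ip (\<lambda>q\<in>\<Omega>. qcnj (spherical_deriv (k q) w)))\<^sup>2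
        - (norm (qcnj (spherical_deriv (k w) w)))\<^sup>2) / (hnorm ip (k w)) ^ 4 * (norm d2)\<^sup>2"
proof -
  interpret quat_rkhs \<Omega> H ip k by fact
  have "open \<Omega>" using assms(1) by (simp add: slice_domain_def)
  have regular: "slice_regular f \<Omega>" if "f \<in> H" for f using assms(4) that by blast
  note w = \<open>w \<in> \<Omega>\<close> and I = \<open>I \<in> imag_units\<close> and wI = \<open>w \<in> slice I\<close>
  let ?C = "\<lambda>q\<in>\<Omega>. qcnj (slice_deriv (k q) w)" and ?S = "\<lambda>q\<in>\<Omega>. qcnj (spherical_deriv (k q) w)"
  let ?c = "slice_deriv (k w) w" and ?s = "spherical_deriv (k w) w"
  have C: "?C \<in> H" using \<open>open \<Omega>\<close> regular w by (rule slice_deriv_representer_mem)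
  show ?thesis
  proof (cases "w \<in> \<real>")
    case True
    have "spherical_deriv (k q) w = slice_deriv (k q) w" if "q \<in> \<Omega>" for q
      using regular[OF kernel_mem[OF that]] \<open>open \<Omega>\<close> w True
      by (rule spherical_deriv_eq_slice_deriv_on_reals)
    then have SC: "?S = ?C" "?s = ?c" using w by (auto simp: fun_eq_iff)
    \<comment> \<open>The splitting along \<open>slice_unit w\<close>, whose slice may differ from that of \<open>I\<close>.\<close>
    define e1 where "e1 = slice_proj (slice_unit w) (d1 + d2)"
    define e2 where "e2 = d1 + d2 - e1"
    let ?d = "d1 + d2"
    have e: "?d = e1 + e2" by (simp add: e2_def)
    have cross: "qre (e2 * ip ?C ?C * qcnj e1) = (hnorm ip ?C)\<^sup>2 * (e1 \<bullet> e2)"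
      by (simp add: ip_self_real[OF C] inner_quat_def quat_sel_mult algebra_simps
          del: of_real_power)
    have "(norm ?d)\<^sup>2 = (norm e1)\<^sup>2 + (norm e2)\<^sup>2 + 2 * (e1 \<bullet> e2)"
      unfolding e norm_quat_square by (simp add: inner_add_left inner_add_right inner_commute)
    moreover have d: "(norm ?d)\<^sup>2 = (norm d1)\<^sup>2 + (norm d2)\<^sup>2"
      using assms by (intro norm_add_orthogonal_slice)
    ultimately have
      "(hnorm ip ?C)\<^sup>2 * (norm e1)\<^sup>2 + (hnorm ip ?C)\<^sup>2 * (norm e2)\<^sup>2 + 2 * qre (e2 * ip ?C ?C * qcnj e1) =
        (hnorm ip ?C)\<^sup>2 * ((norm d1)\<^sup>2 + (norm d2)\<^sup>2)"
      unfolding cross by (simp add: distrib_left)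
    moreover have "(norm (e1 * ?c + e2 * ?c))\<^sup>2 = ((norm d1)\<^sup>2 + (norm d2)\<^sup>2) * (norm ?c)\<^sup>2"
      by (simp only: distrib_right[symmetric] e[symmetric] norm_mult power_mult_distrib d)
    ultimately have "rkhs_metric_sq \<Omega> ip k w ?d =
        ((hnorm ip (k w))\<^sup>2 * ((hnorm ip ?C)\<^sup>2 * ((norm d1)\<^sup>2 + (norm d2)\<^sup>2)) -
          ((norm d1)\<^sup>2 + (norm d2)\<^sup>2) * (norm ?c)\<^sup>2) / (hnorm ip (k w)) ^ 4"
      using rkhs_metric_sq_eq[OF C _ w e1_def[symmetric] e] C unfolding SC by simp
    then show ?thesis
      unfolding SC by (simp add: field_simps flip: add_divide_distrib)
  next
    case False
    have "slice (slice_unit w) = slice I"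
      using slice_unit[of w] I wI False by (intro slice_eq_if_common_nonreal_point)
    then have proj: "slice_proj (slice_unit w) (d1 + d2) = d1"
      using slice_proj_decomp[OF slice_unit(1)[of w]] assms by simp
    have w': "qcnj w \<in> \<Omega>" "qcnj w \<in> slice I"
      using symmetric_domain_qcnj[OF assms(2) w] slice_qcnj[OF I wI] .
    note S = spherical_deriv_representer[OF w w'(1) False]
    have pres: "k q ` (\<Omega> \<inter> slice I) \<subseteq> slice I" if "q \<in> \<Omega>" "q \<in> slice I" for q
      using assms(5) that I by (auto simp: slice_preserving_kernel_def)
    have sd: "slice_deriv (k q) w \<in> slice I" if "q \<in> \<Omega>" "q \<in> slice I" for q
      by (rule slice_deriv_mem_slice[OF regular[OF kernel_mem[OF that(1)]] \<open>open \<Omega>\<close> w wI I pres[OF that]])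
    have sph: "spherical_deriv f w \<in> slice I" if "f w \<in> slice I" "f (qcnj w) \<in> slice I" for f
      using False that w' wI I
      by (auto simp: spherical_deriv_def intro!: slice_mult slice_inverse slice_diff)
    have c: "?c \<in> slice I" using w wI by (rule sd)
    have s: "?s \<in> slice I" using pres[OF w wI] w w' wI by (intro sph) auto
    have CS: "ip ?C ?S \<in> slice I"
      unfolding S(2)[OF C] using w w' wI I by (intro sph) (auto intro: slice_qcnj sd)
    have "d2 * (ip ?C ?S * qcnj d1) \<in> orthogonal_comp (slice I)"
      using I CS assms by (intro orthogonal_comp_slice_mult slice_mult slice_qcnj)
    from slice_inner_orthogonal_comp[OF of_real_mem_slice[of 1] this]
    have cross: "qre (d2 * ip ?C ?S * qcnj d1) = 0"
      by (simp add: inner_quat_def mult.assoc)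
    have "(norm (d1 * ?c + d2 * ?s))\<^sup>2 = (norm d1)\<^sup>2 * (norm ?c)\<^sup>2 + (norm d2)\<^sup>2 * (norm ?s)\<^sup>2"
      using norm_add_orthogonal_slice[OF slice_mult[OF I \<open>d1 \<in> slice I\<close> c]
          orthogonal_comp_slice_mult[OF I s \<open>d2 \<in> orthogonal_comp (slice I)\<close>]]
      by (simp add: norm_mult power_mult_distrib)
    then show ?thesis
      unfolding rkhs_metric_sq_eq[OF C S(1) w proj refl] cross
      by (simp add: field_simps flip: add_divide_distrib)
  qed
qed

end
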